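(* Let $\mathcal S_n=(\mathcal V,(m_k)_{0\le k\le n})$ be a weighted $n$-simplicial (flag) complex whose $1$-skeleton is colorable, with a fixed ordered coloring $c$. For every $k\in\{0,\dots,n\}$, the formula $$U_k:\ell^2_{\mathrm{skew}}(m_k)\to\ell^2_{\mathrm{can}}(m_k),\qquad (U_kf)(|\sigma|):=f(\sigma_{\mathrm{can}}),$$ defines a unitary operator. Writing $M_k^{\mathrm{skew}}$, $M_k^{\mathrm{can}}$ for multiplication by $m_k$ on the two spaces, one has $U_kM_k^{\mathrm{skew}}=M_k^{\mathrm{can}}U_k$. Moreover: (1) $d^{k+1}_{\mathrm{sym,can}}\circ d^k_{\mathrm{sym,can}}=0$ (for $1\le k\le n-1$). (2) $U_k$ intertwines the skew and canonical-basis Laplacians: $U_k\,\Delta_{k,\mathrm{skew}}\,U_k^{-1}=\Delta^{\mathrm{can}}_{k,\mathrm{sym}}$. (3) These identities extend to the closed/Friedrichs realizations: $\overline{d^{k+1}_{\mathrm{sym,can}}}\;\overline{d^{k}_{\mathrm{sym,can}}}\,u=0$ whenever the left-hand side is defined, and $U_k\,\Delta^{\mathrm F}_{k,\mathrm{skew}}\,U_k^{-1}=(\Delta^{\mathrm{can}}_{k,\mathrm{sym}})^{\mathrm F}$.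
   Context: Weighted graph: $\mathcal V$ countable, $m_0:\mathcal V\to(0,\infty)$, $m_1:\mathcal V^2\to[0,\infty)$ symmetric, zero on the diagonal; $x\sim y$ iff $m_1(x,y)>0$; $\mathcal N(x)=\{y:y\sim x\}$. Weighted $n$-simplicial (flag) complex, $n\ge1$: $\mathcal F_k$ is the set of ordered $(k+1)$-tuples of distinct pairwise adjacent vertices; $T_k$ is the set of oriented $k$-simplices $[x_0,\dots,x_k]$ (classes of $\mathcal F_k$ modulo even permutations); $|\sigma|$ is the underlying unoriented simplex. The weights $m_k:\mathcal V^{k+1}\to[0,\infty)$ ($0\le k\le n$) are permutation invariant and positive exactly on $\mathcal F_k$. $F_{(x_1,\dots,x_k)}=\bigcap_j\mathcal N(x_j)$. Standing assumption: $\frac1{m_k(\sigma)}\sum_{w\in F_\sigma}m_{k+1}(\sigma,w)<\infty$ for every $k$-simplex $\sigma$, $0\le k\le n-1$. Skew model: $\mathcal C^k(\mathcal V)$ is the space of $f:T_k\to\mathbb C$ with $f([x_{\pi(0)},\dots,x_{\pi(k)}])=\operatorname{sgn}(\pi)f([x_0,\dots,x_k])$ (all functions on $\mathcal V$ if $k=0$); $\mathcal C^k_c(\mathcal V)$ the finitely supported ones; $\ell^2_{\mathrm{skew}}(m_k)$ has inner product $\frac1{(k+1)!}\sum_{\mathcal F_k}m_kf\overline g$. $d^k_{\mathrm{skew}}f([x_0,\dots,x_k])=\sum_i(-1)^if([x_0,\dots,\widehat{x_i},\dots,x_k])$; formal adjoint $\delta^kg([x_1,\dots,x_k])=\frac1{m_{k-1}(x_1,\dots,x_k)}\sum_{x_0\in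 F_{(x_1,\dots,x_k)}}m_k(x_0,\dots,x_k)g([x_0,\dots,x_k])$; $\Delta_{k,\mathrm{skew}}=d^k\delta^k+\delta^{k+1}d^{k+1}$ on $\mathcal C^k_c(\mathcal V)$, with $\delta^0=0$, $d^{n+1}=0$; formulas are read pointwise. Coloring: an ordered coloring is a map $c:\mathcal V\to C$ into a totally ordered set with $c(x)\ne c(y)$ whenever $x\sim y$; colorable means one exists. For a $k$-simplex $\sigma$, $\sigma_{\mathrm{can}}=[y_0,\dots,y_k]$ with its vertices listed so that $c(y_0)<\dots<c(y_k)$. Canonical-basis model: $\ell^2_{\mathrm{can}}(m_k)$ is the space of functions on unoriented $k$-simplices with inner product $\sum_{|\sigma|}m_k(|\sigma|)f(|\sigma|)\overline{g(|\sigma|)}$; its core is the finitely supported functions. For $\sigma_{\mathrm{can}}=[x_0,\dots,x_k]$ in color-increasing order, $(d^k_{\mathrm{sym,can}}f)(|\sigma|)=\sum_{i=0}^k(-1)^if(|\tau_i|)$, $\tau_i=[x_0,\dots,\widehat{x_i},\dots,x_k]$. $\delta^k_{\mathrm{sym,can}}=U_{k-1}\delta^kU_k^{-1}$ is its formal adjoint, and $\Delta^{\mathrm{can}}_{k,\mathrm{sym}}=d^k_{\mathrm{sym,can}}\delta^k_{\mathrm{sym,can}}+\delta^{k+1}_{\mathrm{sym,can}}d^{k+1}_{\mathrm{sym,can}}$ on the core. Realizations: $\overline{A}$ denotes the operator closure of $A$ from the core. $\Delta^{\mathrm F}_{k,\mathrm{skew}}$ is the self-adjoint operator associated with the closure of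 the form $\|d^{k+1}u\|^2_{k+1}+\|\delta^ku\|^2_{k-1}$ on $\mathcal C^k_c(\mathcal V)$, and $(\Delta^{\mathrm{can}}_{k,\mathrm{sym}})^{\mathrm F}$ is defined in the same way in the canonical model. *)

theory Defs
  imports "HOL-Analysis.Analysis" "HOL-Combinatorics.Permutations"
begin

section \<open>Weighted flag complexes\<close>

text \<open>The tuple \<open>(x\<^sub>0, \<dots>, x\<^sub>k)\<close> is the list of its \<open>k + 1\<close> entries and \<open>m\<^sub>k\<close> is \<open>wt S k\<close>; only
  \<open>k \<le> top_dim S\<close> and lists of length \<open>k + 1\<close> over \<open>verts S\<close> are meaningful.\<close>

record 'v wcomplex =
  verts :: "'v set"
  top_dim :: nat
  wt :: "nat \<Rightarrow> 'v list \<Rightarrow> real"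

definition adjacent :: "'v wcomplex \<Rightarrow> 'v \<Rightarrow> 'v \<Rightarrow> bool" where
  "adjacent S x y \<longleftrightarrow> x \<in> verts S \<and> y \<in> verts S \<and> wt S 1 [x, y] > 0"

definition nbhd :: "'v wcomplex \<Rightarrow> 'v \<Rightarrow> 'v set" where
  "nbhd S x = {y. adjacent S y x}"

definition common_nbhd :: "'v wcomplex \<Rightarrow> 'v list \<Rightarrow> 'v set" where
  "common_nbhd S xs = (\<Inter>x\<in>set xs. nbhd S x)"

definition tuples :: "'v wcomplex \<Rightarrow> nat \<Rightarrow> 'v list set" where
  "tuples S k = {xs. length xs = Suc k \<and> set xs \<subseteq> verts S \<and> distinct xs \<and>
     (\<forall>x\<in>set xs. \<forall>y\<in>set xs. x \<noteq> y \<longrightarrow> adjacent S x y)}"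

text \<open>Positivity exactly on \<^term>\<open>tuples S k\<close> makes \<open>m\<^sub>0\<close> strictly positive and \<open>m\<^sub>1\<close> zero on the
  diagonal; permutation invariance contains the symmetry of \<open>m\<^sub>1\<close>. The last clause says that
  \<open>(1 / m\<^sub>k(\<sigma>)) \<Sum>\<^sub>w m\<^sub>k\<^sub>+\<^sub>1(\<sigma>, w)\<close>, a sum of nonnegative terms, is finite.\<close>

definition weighted_flag_complex :: "'v wcomplex \<Rightarrow> bool" where
  "weighted_flag_complex S \<longleftrightarrow>
     countable (verts S) \<and> 1 \<le> top_dim S \<and>
     (\<forall>k\<le>top_dim S. \<forall>xs. length xs = Suc k \<and> set xs \<subseteq> verts S \<longrightarrow>
        0 \<le> wt S k xs \<and>
        (0 < wt S k xs \<longleftrightarrow> xs \<in> tuples S k) \<and>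
        (\<forall>ys. mset ys = mset xs \<longrightarrow> wt S k ys = wt S k xs)) \<and>
     (\<forall>k<top_dim S. \<forall>xs\<in>tuples S k.
        (\<lambda>w. 1 / wt S k xs * wt S (Suc k) (xs @ [w])) summable_on common_nbhd S xs)"

text \<open>An oriented simplex is the class of a tuple modulo even permutations.\<close>

definition orient :: "'v list \<Rightarrow> 'v list set" where
  "orient xs = {permute_list p xs | p. p permutes {..<length xs} \<and> evenperm p}"

definition osimplices :: "'v wcomplex \<Rightarrow> nat \<Rightarrow> 'v list set set" where
  "osimplices S k = orient ` tuples S k"

definition rep :: "'v list set \<Rightarrow> 'v list" where
  "rep \<sigma> = (SOME xs. xs \<in> \<sigma>)"

text \<open>An unoriented simplex is its set of vertices. By permutation invariance its weight does not
  depend on the chosen ordering.\<close>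

definition usimplices :: "'v wcomplex \<Rightarrow> nat \<Rightarrow> 'v set set" where
  "usimplices S k = set ` tuples S k"

definition uwt :: "'v wcomplex \<Rightarrow> nat \<Rightarrow> 'v set \<Rightarrow> real" where
  "uwt S k s = wt S k (SOME xs. xs \<in> tuples S k \<and> set xs = s)"

definition face :: "nat \<Rightarrow> 'v list \<Rightarrow> 'v list" where
  "face i xs = take i xs @ drop (Suc i) xs"

definition ordered_coloring :: "'v wcomplex \<Rightarrow> ('v \<Rightarrow> 'c::linorder) \<Rightarrow> bool" where
  "ordered_coloring S c \<longleftrightarrow> (\<forall>x y. adjacent S x y \<longrightarrow> c x \<noteq> c y)"

text \<open>The vertices of \<open>s\<close> in increasing order of color.\<close>

definition can_list :: "('v \<Rightarrow> 'c::linorder) \<Rightarrow> 'v set \<Rightarrow> 'v list" where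
  "can_list c s = (THE ys. set ys = s \<and> sorted_wrt (\<lambda>x y. c x < c y) ys)"


section \<open>Operators and forms in weighted sequence spaces\<close>

text \<open>A function on a set of simplices is a total function vanishing outside that set. The
  definitions of this section take as parameters subspaces of such functions and inner products
  \<open>ip\<close>, which are linear in the first argument. An unbounded operator is given by its graph.\<close>

definition norm_conv ::
  "(('i \<Rightarrow> complex) \<Rightarrow> ('i \<Rightarrow> complex) \<Rightarrow> complex) \<Rightarrow> (nat \<Rightarrow> 'i \<Rightarrow> complex) \<Rightarrow> ('i \<Rightarrow> complex) \<Rightarrow> bool"
where
  "norm_conv ip us u \<longleftrightarrow> (\<lambda>j. sqrt (Re (ip (\<lambda>x. us j x - u x) (\<lambda>x. us j x - u x)))) \<longlonglongrightarrow> 0"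

definition unitary_between ::
  "('i \<Rightarrow> complex) set \<Rightarrow> (('i \<Rightarrow> complex) \<Rightarrow> ('i \<Rightarrow> complex) \<Rightarrow> complex) \<Rightarrow>
   ('j \<Rightarrow> complex) set \<Rightarrow> (('j \<Rightarrow> complex) \<Rightarrow> ('j \<Rightarrow> complex) \<Rightarrow> complex) \<Rightarrow>
   (('i \<Rightarrow> complex) \<Rightarrow> ('j \<Rightarrow> complex)) \<Rightarrow> bool"
where
  "unitary_between H ipH K ipK W \<longleftrightarrow>
     (\<forall>f\<in>H. \<forall>g\<in>H. \<forall>a b. W (\<lambda>x. a * f x + b * g x) = (\<lambda>y. a * W f y + b * W g y)) \<and>
     bij_betw W H K \<and>
     (\<forall>f\<in>H. \<forall>g\<in>H. ipK (W f) (W g) = ipH f g)"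

definition op_on :: "'a set \<Rightarrow> ('a \<Rightarrow> 'b) \<Rightarrow> ('a \<times> 'b) set" where
  "op_on D A = {(u, A u) | u. u \<in> D}"

text \<open>For \<open>W\<close> injective this is the graph of the operator \<open>W A W\<inverse>\<close> with its natural domain.\<close>

definition conjugate_op :: "('a \<Rightarrow> 'b) \<Rightarrow> ('a \<times> 'a) set \<Rightarrow> ('b \<times> 'b) set" where
  "conjugate_op W A = {(W u, W h) | u h. (u, h) \<in> A}"

text \<open>The operator closure of \<open>A\<close> from the core \<open>D\<close>: the closure in \<open>H \<times> K\<close> of the graph of \<open>A\<close>
  on \<open>D\<close>.\<close>

definition closed_op ::
  "('i \<Rightarrow> complex) set \<Rightarrow> (('i \<Rightarrow> complex) \<Rightarrow> ('i \<Rightarrow> complex) \<Rightarrow> complex) \<Rightarrow>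
   ('j \<Rightarrow> complex) set \<Rightarrow> (('j \<Rightarrow> complex) \<Rightarrow> ('j \<Rightarrow> complex) \<Rightarrow> complex) \<Rightarrow>
   ('i \<Rightarrow> complex) set \<Rightarrow> (('i \<Rightarrow> complex) \<Rightarrow> ('j \<Rightarrow> complex)) \<Rightarrow>
   (('i \<Rightarrow> complex) \<times> ('j \<Rightarrow> complex)) set"
where
  "closed_op H ipH K ipK D A =
     {(u, v). u \<in> H \<and> v \<in> K \<and>
        (\<exists>us. (\<forall>j. us j \<in> D \<and> A (us j) \<in> K) \<and>
           norm_conv ipH us u \<and> norm_conv ipK (\<lambda>j. A (us j)) v)}"

text \<open>Closure of a nonnegative form \<open>q\<close> on the core \<open>D\<close>: \<open>u\<close> lies in its domain iff some sequence
  in \<open>D\<close> converges to \<open>u\<close> and is Cauchy for \<open>q\<close>, and values are limits along such sequences.\<close>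

definition form_approx ::
  "(('i \<Rightarrow> complex) \<Rightarrow> ('i \<Rightarrow> complex) \<Rightarrow> complex) \<Rightarrow> ('i \<Rightarrow> complex) set \<Rightarrow>
   (('i \<Rightarrow> complex) \<Rightarrow> ('i \<Rightarrow> complex) \<Rightarrow> complex) \<Rightarrow> (nat \<Rightarrow> 'i \<Rightarrow> complex) \<Rightarrow> ('i \<Rightarrow> complex) \<Rightarrow> bool"
where
  "form_approx ip D q us u \<longleftrightarrow>
     (\<forall>j. us j \<in> D) \<and> norm_conv ip us u \<and>
     (\<forall>e>0. \<exists>N. \<forall>i\<ge>N. \<forall>j\<ge>N. Re (q (\<lambda>x. us i x - us j x) (\<lambda>x. us i x - us j x)) < e)"

definition form_closure_dom ::
  "('i \<Rightarrow> complex) set \<Rightarrow> (('i \<Rightarrow> complex) \<Rightarrow> ('i \<Rightarrow> complex) \<Rightarrow> complex) \<Rightarrow> ('i \<Rightarrow> complex) set \<Rightarrow>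
   (('i \<Rightarrow> complex) \<Rightarrow> ('i \<Rightarrow> complex) \<Rightarrow> complex) \<Rightarrow> ('i \<Rightarrow> complex) set"
where
  "form_closure_dom H ip D q = {u \<in> H. \<exists>us. form_approx ip D q us u}"

definition form_closure ::
  "(('i \<Rightarrow> complex) \<Rightarrow> ('i \<Rightarrow> complex) \<Rightarrow> complex) \<Rightarrow> ('i \<Rightarrow> complex) set \<Rightarrow>
   (('i \<Rightarrow> complex) \<Rightarrow> ('i \<Rightarrow> complex) \<Rightarrow> complex) \<Rightarrow> ('i \<Rightarrow> complex) \<Rightarrow> ('i \<Rightarrow> complex) \<Rightarrow> complex"
where
  "form_closure ip D q u v =
     (THE z. \<forall>us vs. form_approx ip D q us u \<and> form_approx ip D q vs v \<longrightarrow>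
        (\<lambda>j. q (us j) (vs j)) \<longlonglongrightarrow> z)"

text \<open>The operator associated with the closed form, as in the first representation theorem:
  \<open>A u = h\<close> iff \<open>u\<close> is in the form domain and the closed form at \<open>(u, v)\<close> is \<open>ip h v\<close> for every \<open>v\<close>
  in the form domain.\<close>

definition friedrichs_op ::
  "('i \<Rightarrow> complex) set \<Rightarrow> (('i \<Rightarrow> complex) \<Rightarrow> ('i \<Rightarrow> complex) \<Rightarrow> complex) \<Rightarrow> ('i \<Rightarrow> complex) set \<Rightarrow>
   (('i \<Rightarrow> complex) \<Rightarrow> ('i \<Rightarrow> complex) \<Rightarrow> complex) \<Rightarrow> (('i \<Rightarrow> complex) \<times> ('i \<Rightarrow> complex)) set"
where
  "friedrichs_op H ip D q =
     {(u, h). u \<in> form_closure_dom H ip D q \<and> h \<in> H \<and>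
        (\<forall>v\<in>form_closure_dom H ip D q. form_closure ip D q u v = ip h v)}"


section \<open>The skew model\<close>

text \<open>For \<open>k = 0\<close> the skew-symmetry condition is void.\<close>

definition skew_cochains :: "'v wcomplex \<Rightarrow> nat \<Rightarrow> ('v list set \<Rightarrow> complex) set" where
  "skew_cochains S k = {f. (\<forall>\<sigma>. \<sigma> \<notin> osimplices S k \<longrightarrow> f \<sigma> = 0) \<and>
     (\<forall>xs\<in>tuples S k. \<forall>p. p permutes {..<Suc k} \<longrightarrow>
        f (orient (permute_list p xs)) = of_int (sign p) * f (orient xs))}"

definition skew_core :: "'v wcomplex \<Rightarrow> nat \<Rightarrow> ('v list set \<Rightarrow> complex) set" where
  "skew_core S k = {f \<in> skew_cochains S k. finite {\<sigma>. f \<sigma> \<noteq> 0}}"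

definition skew_l2 :: "'v wcomplex \<Rightarrow> nat \<Rightarrow> ('v list set \<Rightarrow> complex) set" where
  "skew_l2 S k = {f \<in> skew_cochains S k.
     (\<lambda>xs. wt S k xs * (cmod (f (orient xs)))\<^sup>2) summable_on tuples S k}"

definition skew_ip ::
  "'v wcomplex \<Rightarrow> nat \<Rightarrow> ('v list set \<Rightarrow> complex) \<Rightarrow> ('v list set \<Rightarrow> complex) \<Rightarrow> complex"
where
  "skew_ip S k f g = 1 / fact (Suc k) *
     (\<Sum>\<^sub>\<infinity>xs\<in>tuples S k. of_real (wt S k xs) * f (orient xs) * cnj (g (orient xs)))"

definition skew_mult :: "'v wcomplex \<Rightarrow> nat \<Rightarrow> ('v list set \<Rightarrow> complex) \<Rightarrow> 'v list set \<Rightarrow> complex" where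
  "skew_mult S k f = (\<lambda>\<sigma>. of_real (wt S k (rep \<sigma>)) * f \<sigma>)"

text \<open>\<open>d\<^sup>k\<close> maps \<open>(k-1)\<close>-cochains to \<open>k\<close>-cochains and \<open>\<delta>\<^sup>k\<close> maps back; on skew functions the values do
  not depend on the representative \<^term>\<open>rep \<sigma>\<close>. The guards give \<open>\<delta>\<^sup>0 = 0\<close> and \<open>d\<^sup>n\<^sup>+\<^sup>1 = 0\<close>.\<close>

definition d_skew :: "'v wcomplex \<Rightarrow> nat \<Rightarrow> ('v list set \<Rightarrow> complex) \<Rightarrow> 'v list set \<Rightarrow> complex" where
  "d_skew S k f = (\<lambda>\<sigma>.
     if 1 \<le> k \<and> k \<le> top_dim S \<and> \<sigma> \<in> osimplices S k
     then \<Sum>i\<le>k. (-1) ^ i * f (orient (face i (rep \<sigma>))) else 0)"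

definition delta_skew :: "'v wcomplex \<Rightarrow> nat \<Rightarrow> ('v list set \<Rightarrow> complex) \<Rightarrow> 'v list set \<Rightarrow> complex" where
  "delta_skew S k g = (\<lambda>\<tau>.
     if 1 \<le> k \<and> k \<le> top_dim S \<and> \<tau> \<in> osimplices S (k - 1)
     then 1 / of_real (wt S (k - 1) (rep \<tau>)) *
       (\<Sum>\<^sub>\<infinity>x\<in>common_nbhd S (rep \<tau>). of_real (wt S k (x # rep \<tau>)) * g (orient (x # rep \<tau>)))
     else 0)"

definition laplace_skew :: "'v wcomplex \<Rightarrow> nat \<Rightarrow> ('v list set \<Rightarrow> complex) \<Rightarrow> 'v list set \<Rightarrow> complex"
where
  "laplace_skew S k f = (\<lambda>\<sigma>.
     d_skew S k (delta_skew S k f) \<sigma> + delta_skew S (Suc k) (d_skew S (Suc k) f) \<sigma>)"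

text \<open>The sesquilinear form of \<open>\<parallel>d\<^sup>k\<^sup>+\<^sup>1 u\<parallel>\<^sup>2 + \<parallel>\<delta>\<^sup>k u\<parallel>\<^sup>2\<close>. For \<open>k = 0\<close> (where \<open>k - 1 = 0\<close> on
  \<^typ>\<open>nat\<close>) the second term vanishes because \<open>\<delta>\<^sup>0 = 0\<close>, and for \<open>k = n\<close> the first one does.\<close>

definition form_skew ::
  "'v wcomplex \<Rightarrow> nat \<Rightarrow> ('v list set \<Rightarrow> complex) \<Rightarrow> ('v list set \<Rightarrow> complex) \<Rightarrow> complex"
where
  "form_skew S k u v =
     skew_ip S (Suc k) (d_skew S (Suc k) u) (d_skew S (Suc k) v) +
     skew_ip S (k - 1) (delta_skew S k u) (delta_skew S k v)"

definition laplace_skew_F ::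
  "'v wcomplex \<Rightarrow> nat \<Rightarrow> (('v list set \<Rightarrow> complex) \<times> ('v list set \<Rightarrow> complex)) set"
where
  "laplace_skew_F S k = friedrichs_op (skew_l2 S k) (skew_ip S k) (skew_core S k) (form_skew S k)"


section \<open>The canonical-basis model\<close>

definition can_cochains :: "'v wcomplex \<Rightarrow> nat \<Rightarrow> ('v set \<Rightarrow> complex) set" where
  "can_cochains S k = {f. \<forall>s. s \<notin> usimplices S k \<longrightarrow> f s = 0}"

definition can_core :: "'v wcomplex \<Rightarrow> nat \<Rightarrow> ('v set \<Rightarrow> complex) set" where
  "can_core S k = {f \<in> can_cochains S k. finite {s. f s \<noteq> 0}}"

definition can_l2 :: "'v wcomplex \<Rightarrow> nat \<Rightarrow> ('v set \<Rightarrow> complex) set" where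
  "can_l2 S k = {f \<in> can_cochains S k.
     (\<lambda>s. uwt S k s * (cmod (f s))\<^sup>2) summable_on usimplices S k}"

definition can_ip ::
  "'v wcomplex \<Rightarrow> nat \<Rightarrow> ('v set \<Rightarrow> complex) \<Rightarrow> ('v set \<Rightarrow> complex) \<Rightarrow> complex"
where
  "can_ip S k f g = (\<Sum>\<^sub>\<infinity>s\<in>usimplices S k. of_real (uwt S k s) * f s * cnj (g s))"

definition can_mult :: "'v wcomplex \<Rightarrow> nat \<Rightarrow> ('v set \<Rightarrow> complex) \<Rightarrow> 'v set \<Rightarrow> complex" where
  "can_mult S k f = (\<lambda>s. of_real (uwt S k s) * f s)"

text \<open>\<open>U\<^sub>k\<close> is given by its formula on all cochains. Likewise \<open>U_inv\<close> is the inverse on all cochains,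
  which restricts to the inverse of the unitary operator between the \<open>\<ell>\<^sup>2\<close> spaces: the Laplacian of a
  finitely supported cochain is defined pointwise and need not be square summable.\<close>

definition U :: "'v wcomplex \<Rightarrow> ('v \<Rightarrow> 'c::linorder) \<Rightarrow> nat \<Rightarrow>
    ('v list set \<Rightarrow> complex) \<Rightarrow> 'v set \<Rightarrow> complex"
where
  "U S c k f = (\<lambda>s. if s \<in> usimplices S k then f (orient (can_list c s)) else 0)"

definition U_inv :: "'v wcomplex \<Rightarrow> ('v \<Rightarrow> 'c::linorder) \<Rightarrow> nat \<Rightarrow>
    ('v set \<Rightarrow> complex) \<Rightarrow> 'v list set \<Rightarrow> complex"
where
  "U_inv S c k = inv_into (skew_cochains S k) (U S c k)"

definition d_can :: "'v wcomplex \<Rightarrow> ('v \<Rightarrow> 'c::linorder) \<Rightarrow> nat \<Rightarrow>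
    ('v set \<Rightarrow> complex) \<Rightarrow> 'v set \<Rightarrow> complex"
where
  "d_can S c k f = (\<lambda>s.
     if 1 \<le> k \<and> k \<le> top_dim S \<and> s \<in> usimplices S k
     then \<Sum>i\<le>k. (-1) ^ i * f (set (face i (can_list c s))) else 0)"

definition delta_can :: "'v wcomplex \<Rightarrow> ('v \<Rightarrow> 'c::linorder) \<Rightarrow> nat \<Rightarrow>
    ('v set \<Rightarrow> complex) \<Rightarrow> 'v set \<Rightarrow> complex"
where
  "delta_can S c k g = U S c (k - 1) (delta_skew S k (U_inv S c k g))"

definition laplace_can :: "'v wcomplex \<Rightarrow> ('v \<Rightarrow> 'c::linorder) \<Rightarrow> nat \<Rightarrow>
    ('v set \<Rightarrow> complex) \<Rightarrow> 'v set \<Rightarrow> complex"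
where
  "laplace_can S c k f = (\<lambda>s.
     d_can S c k (delta_can S c k f) s + delta_can S c (Suc k) (d_can S c (Suc k) f) s)"

definition form_can :: "'v wcomplex \<Rightarrow> ('v \<Rightarrow> 'c::linorder) \<Rightarrow> nat \<Rightarrow>
    ('v set \<Rightarrow> complex) \<Rightarrow> ('v set \<Rightarrow> complex) \<Rightarrow> complex"
where
  "form_can S c k u v =
     can_ip S (Suc k) (d_can S c (Suc k) u) (d_can S c (Suc k) v) +
     can_ip S (k - 1) (delta_can S c k u) (delta_can S c k v)"

definition laplace_can_F :: "'v wcomplex \<Rightarrow> ('v \<Rightarrow> 'c::linorder) \<Rightarrow> nat \<Rightarrow>
    (('v set \<Rightarrow> complex) \<times> ('v set \<Rightarrow> complex)) set"
where
  "laplace_can_F S c k = friedrichs_op (can_l2 S k) (can_ip S k) (can_core S k) (form_can S c k)"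

definition d_can_closed :: "'v wcomplex \<Rightarrow> ('v \<Rightarrow> 'c::linorder) \<Rightarrow> nat \<Rightarrow>
    (('v set \<Rightarrow> complex) \<times> ('v set \<Rightarrow> complex)) set"
where
  "d_can_closed S c k =
     closed_op (can_l2 S (k - 1)) (can_ip S (k - 1)) (can_l2 S k) (can_ip S k)
       (can_core S (k - 1)) (d_can S c k)"

end

theory Submission
  imports Defs
begin

text \<open>
  A skew cochain is determined by its value on one tuple per unoriented simplex, and the coloring
  singles out such a tuple: the increasing one. So \<open>U\<close> is a bijection of the cochain spaces as soon
  as arbitrary values on increasing tuples extend to a skew cochain, and the extension is given by
  the sign \<open>(-1)\<close> to the number of color inversions of a tuple (\<open>skew_cochain_eq_U\<close>,
  \<open>bij_betw_U_cochains\<close>). The product \<open>f * cnj g\<close> of two skew cochains is constant on the \<open>(k + 1)!\<close>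
  orderings of a simplex, and this multiplicity is exactly what the factor \<open>1 / (k + 1)!\<close> in the skew inner product compensates;
  hence \<open>U\<close> is isometric (\<open>sum_over_tuples\<close>, \<open>can_ip_U\<close>).

  Everything about \<open>d\<close> happens at the level of functions of lists. A skew cochain is a function of
  tuples that changes sign when two adjacent entries are exchanged (\<open>skew_cochains_iff\<close>). The
  alternating sum over faces satisfies a recursion along the list, from which one reads off that it
  preserves this antisymmetry, so that \<open>d\<close> does not depend on the chosen representative, and that its
  square is zero (\<open>alternating_alt_face_sum\<close>, \<open>alt_face_sum_alt_face_sum\<close>). Evaluated on an
  increasing tuple, whose faces are again increasing, both coboundaries are this same sum; therefore
  \<open>U\<close> intertwines them (\<open>U_d_skew\<close>), \<open>d \<circ> d = 0\<close> holds in the canonical model, and the statement for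
  \<open>\<delta>\<close> and for the Laplacians follows because \<open>\<delta>\<close> of the canonical model is a conjugate of the skew one.

  For the closures, convergence in the weighted norm implies pointwise convergence since weights of
  simplices are positive, and \<open>d\<close> is a finite sum in every coordinate. So the closed coboundary still
  acts by the pointwise formula (\<open>d_can_closed_pointwise\<close>), and two of them compose to zero. The
  Friedrichs operator is built from the inner product, the core and the form on the core alone;
  \<open>U\<close> carries each of these to its counterpart and therefore carries one operator to the other
  (\<open>conjugate_friedrichs_op\<close>).
\<close>

section \<open>Alternating functions of tuples\<close>

text \<open>Exchanging adjacent entries is the form of antisymmetry that fits recursion on lists; it implies
  the sign rule for all permutations by \<open>alternating_permute_list\<close>.\<close>

definition alternating :: "('v list \<Rightarrow> 'a::comm_ring_1) \<Rightarrow> bool" where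
  "alternating F \<longleftrightarrow> (\<forall>ps x y qs. F (ps @ y # x # qs) = - F (ps @ x # y # qs))"

lemma alternatingD: "alternating F \<Longrightarrow> F (ps @ y # x # qs) = - F (ps @ x # y # qs)"
  unfolding alternating_def by blast

text \<open>Two entries at distance \<open>n\<close> are exchanged by moving past each neighbour in turn and back:
  \<open>2 n - 1\<close> adjacent exchanges, an odd number.\<close>

lemma alternating_exchange:
  assumes "alternating F"
  shows "F (ps @ y # ms @ x # qs) = - F (ps @ x # ms @ y # qs)"
proof (induction ms arbitrary: ps)
  case Nil
  show ?case using alternatingD[OF assms, of ps y x qs] by simp
next
  case (Cons m ms)
  have "F (ps @ x # m # ms @ y # qs) = - F (ps @ m # x # ms @ y # qs)"
    by (rule alternatingD[OF assms])
  also have "\<dots> = F (ps @ m # y # ms @ x # qs)"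
    using Cons.IH[of "ps @ [m]"] by simp
  also have "\<dots> = - F (ps @ y # m # ms @ x # qs)"
    by (rule alternatingD[OF assms])
  finally show ?case by simp
qed

lemma permute_list_transpose:
  "permute_list (Transposition.transpose (length ps) (Suc (length ps + length ms))) (ps @ x # ms @ y # qs) =
     ps @ y # ms @ x # qs"
proof (rule nth_equalityI)
  let ?xs = "ps @ x # ms @ y # qs"
  let ?t = "Transposition.transpose (length ps) (Suc (length ps + length ms))"
  have t: "?t permutes {..<length ?xs}" by (rule permutes_swap_id) auto
  show "length (permute_list ?t ?xs) = length (ps @ y # ms @ x # qs)" by simp
  fix i assume "i < length (permute_list ?t ?xs)"
  then have "permute_list ?t ?xs ! i = ?xs ! ?t i"
    by (simp add: permute_list_nth[OF t])
  also have "\<dots> = (ps @ y # ms @ x # qs) ! i"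
    by (auto simp: Transposition.transpose_def nth_append nth_Cons')
  finally show "permute_list ?t ?xs ! i = (ps @ y # ms @ x # qs) ! i" .
qed

lemma split_at_two:
  assumes "a < b" "b < length xs"
  obtains ps x ms y qs where "xs = ps @ x # ms @ y # qs" "length ps = a"
    "Suc (length ps + length ms) = b"
proof
  show "xs = take a xs @ xs ! a # take (b - Suc a) (drop (Suc a) xs) @ xs ! b # drop (Suc b) xs"
  proof -
    have 1: "xs = take a xs @ xs ! a # drop (Suc a) xs"
      using assms by (simp add: id_take_nth_drop)
    have 2: "drop (Suc a) xs = take (b - Suc a) (drop (Suc a) xs) @ xs ! b # drop (Suc b) xs"
      using assms id_take_nth_drop[of "b - Suc a" "drop (Suc a) xs"] by simp
    show ?thesis
      by (rule trans[OF 1 arg_cong[OF 2, of "\<lambda>zs. take a xs @ xs ! a # zs"]])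
  qed
qed (use assms in auto)

text \<open>A permutation is a product of transpositions, and every transposition contributes one sign.\<close>

lemma alternating_permute_list:
  assumes F: "alternating F" and p: "p permutes {..<length xs}"
  shows "F (permute_list p xs) = of_int (sign p) * F xs"
proof -
  have "\<forall>xs. length xs = n \<longrightarrow> F (permute_list p xs) = of_int (sign p) * F xs"
    if "p permutes {..<n}" for n
    using that finite_lessThan[of n]
  proof (induction p rule: permutes_induct)
    case (swap a b p)
    show ?case
    proof (intro allI impI)
      fix xs :: "'a list" assume len: "length xs = n"
      define a' where "a' = min a b"
      define b' where "b' = max a b"
      have ab: "a' < b'" "b' < length xs" and t: "Transposition.transpose a b = Transposition.transpose a' b'"
        using swap.hyps len by (auto simp: a'_def b'_def min_def max_def transpose_commute)
      obtain ps x ms y qs where xs: "xs = ps @ x # ms @ y # qs"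
        and l: "length ps = a'" "Suc (length ps + length ms) = b'"
        using split_at_two[OF ab] .
      have "F (permute_list (Transposition.transpose a b) xs) = - F xs"
        using permute_list_transpose[of ps ms x y qs] alternating_exchange[OF F, of ps y ms x qs]
        unfolding t l(2)[symmetric] l(1)[symmetric] xs by simp
      moreover have "sign (Transposition.transpose a b \<circ> p) = - sign p"
        using swap.hyps
        by (subst sign_compose) (auto simp: sign_swap_id permutation_swap_id intro: permutes_imp_permutation[of "{..<n}"])
      moreover have "permute_list (Transposition.transpose a b \<circ> p) xs = permute_list p (permute_list (Transposition.transpose a b) xs)"
        using swap.hyps len by (intro permute_list_compose) simp
      ultimately show "F (permute_list (Transposition.transpose a b \<circ> p) xs) = of_int (sign (Transposition.transpose a b \<circ> p)) * F xs"
        using swap.IH len by simp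
    qed
  qed simp_all
  then show ?thesis using p by blast
qed

section \<open>Alternating sums over faces\<close>

definition alt_face_sum :: "('v list \<Rightarrow> complex) \<Rightarrow> 'v list \<Rightarrow> complex" where
  "alt_face_sum F xs = (\<Sum>i<length xs. (-1) ^ i * F (face i xs))"

lemma alt_face_sum_Nil [simp]: "alt_face_sum F [] = 0"
  by (simp add: alt_face_sum_def)

text \<open>The face without the first vertex is \<open>xs\<close>; every other face keeps \<open>x\<close> in front, and its index is
  one larger than the index of the corresponding face of \<open>xs\<close>, whence the minus sign.\<close>

lemma alt_face_sum_Cons: "alt_face_sum F (x # xs) = F xs - alt_face_sum (\<lambda>zs. F (x # zs)) xs"
  by (simp add: alt_face_sum_def face_def sum.lessThan_Suc_shift sum_negf del: sum.lessThan_Suc)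

lemma alt_face_sum_diff: "alt_face_sum (\<lambda>xs. F xs - G xs) xs = alt_face_sum F xs - alt_face_sum G xs"
  by (simp add: alt_face_sum_def right_diff_distrib sum_subtractf)

lemma alt_face_sum_uminus: "alt_face_sum (\<lambda>xs. - F xs) xs = - alt_face_sum F xs"
  by (simp add: alt_face_sum_def sum_negf)

text \<open>By the recursion it suffices to treat an exchange of the first two entries. There the faces
  omitting one of the two are swapped, with opposite signs, and the faces containing both change
  sign by assumption.\<close>

lemma alternating_alt_face_sum:
  assumes "alternating F"
  shows "alternating (alt_face_sum F)"
  unfolding alternating_def
proof (intro allI)
  fix ps :: "'a list" and x y qs
  show "alt_face_sum F (ps @ y # x # qs) = - alt_face_sum F (ps @ x # y # qs)"
    using assms
  proof (induction ps arbitrary: F)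
    case Nil
    have "alt_face_sum (\<lambda>zs. F (y # x # zs)) qs = - alt_face_sum (\<lambda>zs. F (x # y # zs)) qs"
      using alternatingD[OF Nil, of "[]" y x] by (simp flip: alt_face_sum_uminus)
    then show ?case by (simp add: alt_face_sum_Cons)
  next
    case (Cons p ps)
    have "alternating (\<lambda>zs. F (p # zs))"
      unfolding alternating_def using alternatingD[OF Cons.prems, of "p # _"] by (metis append_Cons)
    from Cons.IH[OF this] show ?case
      using alternatingD[OF Cons.prems, of ps y x qs] by (simp add: alt_face_sum_Cons)
  qed
qed

text \<open>Applying the recursion to both sums, the faces \<open>alt_face_sum F xs\<close> cancel and what remains is
  the same statement for \<open>\<lambda>zs. F (x # zs)\<close> on the shorter list.\<close>

lemma alt_face_sum_alt_face_sum: "alt_face_sum (alt_face_sum F) xs = 0"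
proof (induction xs arbitrary: F)
  case (Cons x xs)
  have "alt_face_sum (alt_face_sum F) (x # xs) =
      alt_face_sum F xs - alt_face_sum (\<lambda>zs. F zs - alt_face_sum (\<lambda>ws. F (x # ws)) zs) xs"
    by (simp add: alt_face_sum_Cons)
  then show ?case using Cons.IH by (simp add: alt_face_sum_diff)
qed simp

section \<open>Orientation classes\<close>

lemma self_in_orient: "xs \<in> orient xs"
  unfolding orient_def by (auto intro!: exI[of _ id] simp: permutes_id)

lemma rep_orientE:
  obtains p where "p permutes {..<length xs}" "evenperm p" "rep (orient xs) = permute_list p xs"
proof -
  have "rep (orient xs) \<in> orient xs"
    unfolding rep_def using self_in_orient by (rule someI)
  then show ?thesis using that by (auto simp: orient_def)
qed

text \<open>For this reason the values of a skew cochain, and of everything built from one in an alternating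
  way, are independent of the arbitrary choice made by \<open>rep\<close>.\<close>

lemma alternating_rep_orient:
  assumes "alternating F" shows "F (rep (orient xs)) = F xs"
  by (rule rep_orientE[of xs]) (auto simp: alternating_permute_list[OF assms] sign_def)

lemma mset_rep_orient [simp]: "mset (rep (orient xs)) = mset xs"
  by (rule rep_orientE[of xs]) auto

lemma tuples_mset_cong:
  assumes "mset xs = mset ys" shows "xs \<in> tuples S k \<longleftrightarrow> ys \<in> tuples S k"
  using mset_eq_setD[OF assms] mset_eq_length[OF assms] mset_eq_imp_distinct_iff[OF assms]
  by (simp add: tuples_def)

lemma orient_in_osimplices_iff [simp]: "orient xs \<in> osimplices S k \<longleftrightarrow> xs \<in> tuples S k"
proof
  assume "orient xs \<in> osimplices S k"
  then obtain ys where ys: "ys \<in> tuples S k" "orient xs = orient ys"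
    by (auto simp: osimplices_def)
  have "mset xs = mset ys" using ys(2) mset_rep_orient by metis
  then show "xs \<in> tuples S k" using ys(1) tuples_mset_cong by blast
qed (simp add: osimplices_def)

section \<open>Skew cochains as alternating functions\<close>

text \<open>A class is in \<open>osimplices S k\<close> only if its representatives are tuples, so a skew cochain vanishes
  at \<open>orient xs\<close> for every other list \<open>xs\<close>. Antisymmetry can thus be required of all lists, without
  reference to the complex.\<close>

lemma skew_cochains_iff:
  "f \<in> skew_cochains S k \<longleftrightarrow>
     (\<forall>\<sigma>. \<sigma> \<notin> osimplices S k \<longrightarrow> f \<sigma> = 0) \<and> alternating (\<lambda>xs. f (orient xs))"
proof
  assume f: "f \<in> skew_cochains S k"
  have "f (orient (ps @ y # x # qs)) = - f (orient (ps @ x # y # qs))" for ps x y qs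
  proof (cases "ps @ x # y # qs \<in> tuples S k")
    case True
    let ?t = "Transposition.transpose (length ps) (Suc (length ps))"
    have "length (ps @ x # y # qs) = Suc k" using True by (simp add: tuples_def)
    then have "?t permutes {..<Suc k}"
      by (intro permutes_swap_id) auto
    then have "f (orient (permute_list ?t (ps @ x # y # qs))) = - f (orient (ps @ x # y # qs))"
      using f True by (simp add: skew_cochains_def sign_swap_id)
    then show ?thesis using permute_list_transpose[of ps "[]" x y qs] by simp
  next
    case False
    moreover from this have "ps @ y # x # qs \<notin> tuples S k"
      using tuples_mset_cong[of "ps @ x # y # qs" "ps @ y # x # qs" S k] by simp
    ultimately show ?thesis using f by (simp add: skew_cochains_def)
  qed
  then show "(\<forall>\<sigma>. \<sigma> \<notin> osimplices S k \<longrightarrow> f \<sigma> = 0) \<and> alternating (\<lambda>xs. f (orient xs))"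
    using f unfolding skew_cochains_def alternating_def by blast
next
  assume f: "(\<forall>\<sigma>. \<sigma> \<notin> osimplices S k \<longrightarrow> f \<sigma> = 0) \<and> alternating (\<lambda>xs. f (orient xs))"
  have "f (orient (permute_list p xs)) = of_int (sign p) * f (orient xs)"
    if "xs \<in> tuples S k" "p permutes {..<Suc k}" for xs p
    using alternating_permute_list[of "\<lambda>xs. f (orient xs)" p xs] f that by (simp add: tuples_def)
  then show "f \<in> skew_cochains S k" using f by (simp add: skew_cochains_def)
qed

lemma skew_cochains_alternating: "f \<in> skew_cochains S k \<Longrightarrow> alternating (\<lambda>xs. f (orient xs))"
  by (simp add: skew_cochains_iff)

lemma skew_cochains_eq_0: "f \<in> skew_cochains S k \<Longrightarrow> xs \<notin> tuples S k \<Longrightarrow> f (orient xs) = 0"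
  by (simp add: skew_cochains_iff)

lemma alternating_restrict_tuples:
  assumes "\<And>ps x y qs. ps @ x # y # qs \<in> tuples S k \<Longrightarrow> F (ps @ y # x # qs) = - F (ps @ x # y # qs)"
  shows "alternating (\<lambda>xs. if xs \<in> tuples S k then F xs else 0)"
proof -
  let ?G = "\<lambda>xs. if xs \<in> tuples S k then F xs else 0"
  have "?G (ps @ y # x # qs) = - ?G (ps @ x # y # qs)" for ps x y qs
    using assms[of ps x y qs] tuples_mset_cong[of "ps @ y # x # qs" "ps @ x # y # qs" S k] by auto
  then show ?thesis unfolding alternating_def by blast
qed

text \<open>Cochains are defined by a formula at \<open>rep \<sigma>\<close>; antisymmetry of the formula on tuples makes
  this legitimate and lets it be evaluated at any tuple of the class.\<close>

lemma skew_cochain_of_tuple_function: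
  assumes "\<And>ps x y qs. ps @ x # y # qs \<in> tuples S k \<Longrightarrow> F (ps @ y # x # qs) = - F (ps @ x # y # qs)"
  defines "f \<equiv> \<lambda>\<sigma>. if \<sigma> \<in> osimplices S k then F (rep \<sigma>) else 0"
  shows "f \<in> skew_cochains S k" and "xs \<in> tuples S k \<Longrightarrow> f (orient xs) = F xs"
proof -
  have alt: "alternating (\<lambda>xs. if xs \<in> tuples S k then F xs else 0)"
    using assms(1) by (rule alternating_restrict_tuples)
  have *: "f (orient xs) = (if xs \<in> tuples S k then F xs else 0)" for xs
    using alternating_rep_orient[OF alt, of xs] tuples_mset_cong[OF mset_rep_orient[of xs], of S k]
    by (auto simp: f_def)
  have "\<sigma> \<notin> osimplices S k \<longrightarrow> f \<sigma> = 0" for \<sigma> by (simp add: f_def)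
  then show "f \<in> skew_cochains S k" unfolding skew_cochains_iff using alt by (simp add: *)
  show "xs \<in> tuples S k \<Longrightarrow> f (orient xs) = F xs" by (simp add: *)
qed

lemma d_skew_conv_alt_face_sum:
  "d_skew S k f = (if 1 \<le> k \<and> k \<le> top_dim S then
     (\<lambda>\<sigma>. if \<sigma> \<in> osimplices S k then alt_face_sum (\<lambda>xs. f (orient xs)) (rep \<sigma>) else 0) else (\<lambda>_. 0))"
proof -
  have len: "length (rep \<sigma>) = Suc k" if \<sigma>: "\<sigma> \<in> osimplices S k" for \<sigma>
  proof -
    obtain xs where "xs \<in> tuples S k" "\<sigma> = orient xs" using \<sigma> by (auto simp: osimplices_def)
    then show ?thesis using mset_eq_length[OF mset_rep_orient[of xs]] by (simp add: tuples_def)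
  qed
  show ?thesis
    by (rule ext) (simp add: d_skew_def alt_face_sum_def len lessThan_Suc_atMost)
qed

lemma d_skew_in_skew_cochains:
  assumes "f \<in> skew_cochains S (k - 1)"
  shows "d_skew S k f \<in> skew_cochains S k"
    and "1 \<le> k \<Longrightarrow> k \<le> top_dim S \<Longrightarrow> xs \<in> tuples S k \<Longrightarrow>
      d_skew S k f (orient xs) = alt_face_sum (\<lambda>xs. f (orient xs)) xs"
proof -
  note alt = alternating_alt_face_sum[OF skew_cochains_alternating[OF assms]]
  show "d_skew S k f \<in> skew_cochains S k"
  proof (cases "1 \<le> k \<and> k \<le> top_dim S")
    case True
    then show ?thesis
      using skew_cochain_of_tuple_function(1)[of S k "alt_face_sum (\<lambda>xs. f (orient xs))", OF alternatingD[OF alt]]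
      by (simp only: d_skew_conv_alt_face_sum if_True simp_thms)
  next
    case False
    then show ?thesis by (simp only: d_skew_conv_alt_face_sum if_False) (simp add: skew_cochains_def)
  qed
  show "1 \<le> k \<Longrightarrow> k \<le> top_dim S \<Longrightarrow> xs \<in> tuples S k \<Longrightarrow>
      d_skew S k f (orient xs) = alt_face_sum (\<lambda>xs. f (orient xs)) xs"
    using skew_cochain_of_tuple_function(2)[of S k "alt_face_sum (\<lambda>xs. f (orient xs))" xs, OF alternatingD[OF alt]]
    by (simp add: d_skew_conv_alt_face_sum)
qed

section \<open>Increasing lists and the sign of a tuple\<close>

lemma can_list_eqI:
  assumes "set ys = s" "sorted_wrt (\<lambda>x y. c x < c y) ys"
  shows "can_list c s = ys"
  unfolding can_list_def
proof (rule the_equality)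
  fix zs assume zs: "set zs = s \<and> sorted_wrt (\<lambda>x y. c x < c y) zs"
  have str: "sorted_wrt (<) (map c ys)" "sorted_wrt (<) (map c zs)"
    using zs assms by (simp_all add: sorted_wrt_map)
  then have "map c zs = map c ys"
    using zs assms by (intro sorted_distinct_set_unique) (auto simp: strict_sorted_iff)
  moreover have "inj_on c s"
    using str assms by (auto simp: strict_sorted_iff distinct_map)
  ultimately show "zs = ys"
    using zs assms(1) by (auto intro: map_inj_on)
qed (use assms in simp)

text \<open>The sign of the permutation that sorts \<open>xs\<close> by color, computed by counting inversions. As a
  product over positions it is visibly alternating, and no permutation has to be chosen.\<close>

fun inversion_sign :: "('v \<Rightarrow> 'c::linorder) \<Rightarrow> 'v list \<Rightarrow> complex" where
  "inversion_sign c [] = 1"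
| "inversion_sign c (x # xs) = (-1) ^ length (filter (\<lambda>y. c y < c x) xs) * inversion_sign c xs"

lemma inversion_sign_swap:
  assumes "c x \<noteq> c y"
  shows "inversion_sign c (ps @ y # x # qs) = - inversion_sign c (ps @ x # y # qs)"
proof (induction ps)
  case Nil
  show ?case using assms by (cases "c x < c y") auto
next
  case (Cons p ps)
  have "length (filter (\<lambda>z. c z < c p) (ps @ y # x # qs)) = length (filter (\<lambda>z. c z < c p) (ps @ x # y # qs))"
    by simp
  then show ?case using Cons.IH by (simp del: filter_append)
qed

lemma inversion_sign_sorted: "sorted_wrt (\<lambda>x y. c x < c y) xs \<Longrightarrow> inversion_sign c xs = 1"
proof (induction xs)
  case (Cons x xs)
  then have "filter (\<lambda>y. c y < c x) xs = []" by (auto simp: filter_empty_conv)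
  then show ?case using Cons by simp
qed simp

lemma inversion_sign_cases: "inversion_sign c xs = 1 \<or> inversion_sign c xs = -1"
proof (induction xs)
  case (Cons x xs)
  then show ?case by (cases "even (length (filter (\<lambda>y. c y < c x) xs))") auto
qed simp

section \<open>Sums over a product with a finite set\<close>

lemma has_sum_finite_times:
  fixes h :: "'a \<Rightarrow> 'b::real_normed_algebra_1"
  assumes "finite P" "(h has_sum v) A"
  shows "((\<lambda>(p, s). h s) has_sum of_nat (card P) * v) (P \<times> A)"
  using assms(1)
proof (induction P rule: finite_induct)
  case (insert p P)
  have "((\<lambda>(p, s). h s) has_sum v) (Pair p ` A)"
    using assms(2) by (subst has_sum_reindex) (auto simp: inj_on_def o_def)
  from has_sum_Un_disjoint[OF this insert.IH] insert.hyps
  have "((\<lambda>(p, s). h s) has_sum v + of_nat (card P) * v) (Pair p ` A \<union> P \<times> A)" by auto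
  moreover have "Pair p ` A \<union> P \<times> A = insert p P \<times> A" by auto
  ultimately show ?case using insert.hyps by (simp add: algebra_simps)
qed simp

lemma summable_on_finite_times_iff:
  fixes h :: "'a \<Rightarrow> 'b::{real_normed_algebra_1, banach}"
  assumes "finite P" "P \<noteq> {}"
  shows "(\<lambda>(p, s). h s) summable_on P \<times> A \<longleftrightarrow> h summable_on A"
proof
  assume *: "(\<lambda>(p, s). h s) summable_on P \<times> A"
  obtain p where "p \<in> P" using assms(2) by blast
  then have "(\<lambda>(p, s). h s) summable_on Pair p ` A"
    using * by (auto intro: summable_on_subset_banach)
  then show "h summable_on A" by (subst (asm) summable_on_reindex) (auto simp: inj_on_def o_def)
next
  assume "h summable_on A"
  then show "(\<lambda>(p, s). h s) summable_on P \<times> A"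
    using has_sum_finite_times[OF assms(1) has_sum_infsum] by (auto simp: summable_on_def)
qed

lemma infsum_finite_times:
  fixes h :: "'a \<Rightarrow> 'b::{real_normed_algebra_1, banach}"
  assumes "finite P" "P \<noteq> {}"
  shows "infsum (\<lambda>(p, s). h s) (P \<times> A) = of_nat (card P) * infsum h A"
proof (cases "h summable_on A")
  case True
  then show ?thesis
    by (intro infsumI has_sum_finite_times[OF assms(1)] has_sum_infsum)
next
  case False
  then show ?thesis
    using summable_on_finite_times_iff[OF assms, of h A] by (simp add: infsum_not_exists)
qed

section \<open>Unitary transport of form operators\<close>

text \<open>\<open>D\<close> is the core of the form \<open>q\<close> in \<open>H\<close>. On the side of \<open>K\<close> the core is \<open>W ` D\<close>, and \<open>q'\<close> is
  tied to \<open>q\<close> only there: the closures evaluate a form at elements of its core and nowhere else.\<close>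

locale unitary_transport =
  fixes H D :: "('i \<Rightarrow> complex) set" and K :: "('j \<Rightarrow> complex) set"
    and ipH q :: "('i \<Rightarrow> complex) \<Rightarrow> ('i \<Rightarrow> complex) \<Rightarrow> complex"
    and ipK q' :: "('j \<Rightarrow> complex) \<Rightarrow> ('j \<Rightarrow> complex) \<Rightarrow> complex"
    and W :: "('i \<Rightarrow> complex) \<Rightarrow> ('j \<Rightarrow> complex)"
  assumes unitary: "unitary_between H ipH K ipK W"
    and diff_H: "f \<in> H \<Longrightarrow> g \<in> H \<Longrightarrow> (\<lambda>x. f x - g x) \<in> H"
    and core_subset: "D \<subseteq> H"
    and diff_core: "f \<in> D \<Longrightarrow> g \<in> D \<Longrightarrow> (\<lambda>x. f x - g x) \<in> D"
    and form_eq: "f \<in> D \<Longrightarrow> g \<in> D \<Longrightarrow> q' (W f) (W g) = q f g"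
begin

lemma W_ip: "f \<in> H \<Longrightarrow> g \<in> H \<Longrightarrow> ipK (W f) (W g) = ipH f g"
  and W_bij: "bij_betw W H K"
  using unitary by (simp_all add: unitary_between_def)

lemma W_diff:
  assumes "f \<in> H" "g \<in> H"
  shows "(\<lambda>y. W f y - W g y) = W (\<lambda>x. f x - g x)"
proof -
  have "W (\<lambda>x. 1 * f x + (-1) * g x) = (\<lambda>y. 1 * W f y + (-1) * W g y)"
    using unitary assms unfolding unitary_between_def by blast
  then show ?thesis by simp
qed

lemma norm_conv_W:
  assumes "\<And>j. us j \<in> H" "u \<in> H"
  shows "norm_conv ipK (\<lambda>j. W (us j)) (W u) \<longleftrightarrow> norm_conv ipH us u"
  by (simp only: norm_conv_def W_diff[OF assms] W_ip diff_H assms)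

lemma form_approx_W:
  assumes us: "\<And>j. us j \<in> D" and u: "u \<in> H"
  shows "form_approx ipK (W ` D) q' (\<lambda>j. W (us j)) (W u) \<longleftrightarrow> form_approx ipH D q us u"
proof -
  have usH: "us j \<in> H" for j using us core_subset by blast
  have "q' (\<lambda>x. W (us i) x - W (us j) x) (\<lambda>x. W (us i) x - W (us j) x) =
      q (\<lambda>x. us i x - us j x) (\<lambda>x. us i x - us j x)" for i j
    unfolding W_diff[OF usH usH] by (intro form_eq diff_core us)
  then show ?thesis
    unfolding form_approx_def using norm_conv_W[of us u] usH u us by simp
qed

lemma sequence_in_image_core:
  assumes "\<And>j. vs j \<in> W ` D"
  obtains us where "\<And>j. us j \<in> D" "vs = (\<lambda>j. W (us j))"
proof -
  have "\<forall>j. \<exists>u. u \<in> D \<and> vs j = W u" using assms by blast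
  then obtain us where "\<forall>j. us j \<in> D \<and> vs j = W (us j)" by metis
  then show ?thesis using that[of us] by auto
qed

text \<open>Every approximating sequence on the side of \<open>K\<close> is the image of one on the side of \<open>H\<close>. This
  matters because the closed form quantifies over all approximating sequences.\<close>

lemma form_approx_image:
  assumes "u \<in> H"
  shows "form_approx ipK (W ` D) q' vs (W u) \<longleftrightarrow> (\<exists>us. vs = (\<lambda>j. W (us j)) \<and> form_approx ipH D q us u)"
proof
  assume vs: "form_approx ipK (W ` D) q' vs (W u)"
  then have "vs j \<in> W ` D" for j by (simp add: form_approx_def)
  then obtain us where "\<And>j. us j \<in> D" "vs = (\<lambda>j. W (us j))" using sequence_in_image_core by metis
  then show "\<exists>us. vs = (\<lambda>j. W (us j)) \<and> form_approx ipH D q us u"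
    using vs form_approx_W[of us u] assms by blast
next
  assume "\<exists>us. vs = (\<lambda>j. W (us j)) \<and> form_approx ipH D q us u"
  then obtain us where us: "vs = (\<lambda>j. W (us j))" "form_approx ipH D q us u" by blast
  moreover have "us j \<in> D" for j using us(2) by (simp add: form_approx_def)
  ultimately show "form_approx ipK (W ` D) q' vs (W u)" using form_approx_W assms by blast
qed

lemma form_closure_dom_image:
  "form_closure_dom K ipK (W ` D) q' = W ` form_closure_dom H ipH D q"
proof -
  have K: "K = W ` H" using W_bij by (simp add: bij_betw_def)
  have "(\<exists>vs. form_approx ipK (W ` D) q' vs (W u)) \<longleftrightarrow> (\<exists>us. form_approx ipH D q us u)"
    if "u \<in> H" for u using form_approx_image[OF that] by blast
  then show ?thesis unfolding form_closure_dom_def K by blast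
qed

text \<open>The two descriptions of the value of the closed form hold for the same complex numbers \<open>z\<close>.
  Hence the definite descriptions agree, whether or not such a \<open>z\<close> exists and is unique.\<close>

lemma form_closure_W:
  assumes "u \<in> H" "v \<in> H"
  shows "form_closure ipK (W ` D) q' (W u) (W v) = form_closure ipH D q u v"
proof -
  have eq: "q' (W (us j)) (W (vs j)) = q (us j) (vs j)"
    if "form_approx ipH D q us u" "form_approx ipH D q vs v" for us vs j
    using that by (intro form_eq) (auto simp: form_approx_def)
  have "(\<forall>us vs. form_approx ipK (W ` D) q' us (W u) \<and> form_approx ipK (W ` D) q' vs (W v) \<longrightarrow>
        (\<lambda>j. q' (us j) (vs j)) \<longlonglongrightarrow> z) \<longleftrightarrow>
      (\<forall>us vs. form_approx ipH D q us u \<and> form_approx ipH D q vs v \<longrightarrow>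
        (\<lambda>j. q' (W (us j)) (W (vs j))) \<longlonglongrightarrow> z)" for z
    unfolding form_approx_image[OF assms(1)] form_approx_image[OF assms(2)] by blast
  then show ?thesis unfolding form_closure_def by (simp add: eq cong: conj_cong imp_cong)
qed

lemma conjugate_friedrichs_op:
  "conjugate_op W (friedrichs_op H ipH D q) = friedrichs_op K ipK (W ` D) q'"
proof -
  have dom: "u \<in> H" if "u \<in> form_closure_dom H ipH D q" for u
    using that by (simp add: form_closure_dom_def)
  have K: "K = W ` H" using W_bij by (simp add: bij_betw_def)
  have iff: "(W u, W h) \<in> friedrichs_op K ipK (W ` D) q' \<longleftrightarrow> (u, h) \<in> friedrichs_op H ipH D q"
    if "u \<in> H" "h \<in> H" for u h
  proof -
    have "W u \<in> W ` form_closure_dom H ipH D q \<longleftrightarrow> u \<in> form_closure_dom H ipH D q"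
      using W_bij that dom by (auto simp: bij_betw_def inj_on_def)
    then show ?thesis
      unfolding friedrichs_op_def form_closure_dom_image
      using that dom by (auto simp: K form_closure_W W_ip)
  qed
  show ?thesis
  proof (intro equalityI subsetI)
    fix z assume "z \<in> conjugate_op W (friedrichs_op H ipH D q)"
    then obtain u h where uh: "z = (W u, W h)" "(u, h) \<in> friedrichs_op H ipH D q"
      by (auto simp: conjugate_op_def)
    then have "u \<in> H" "h \<in> H" using dom by (auto simp: friedrichs_op_def)
    then show "z \<in> friedrichs_op K ipK (W ` D) q'" using iff uh by blast
  next
    fix z assume z: "z \<in> friedrichs_op K ipK (W ` D) q'"
    then have "fst z \<in> form_closure_dom K ipK (W ` D) q'" "snd z \<in> K"
      by (auto simp: friedrichs_op_def)
    then have "fst z \<in> W ` H" "snd z \<in> W ` H"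
      unfolding form_closure_dom_image using dom K by blast+
    then obtain u h where "u \<in> H" "h \<in> H" "z = (W u, W h)" by (metis imageE prod.collapse)
    then show "z \<in> conjugate_op W (friedrichs_op H ipH D q)"
      using iff z by (auto simp: conjugate_op_def)
  qed
qed

end

section \<open>Simplices of a colored complex\<close>

locale colored_complex =
  fixes S :: "'v wcomplex" and c :: "'v \<Rightarrow> 'c::linorder"
  assumes complex: "weighted_flag_complex S" and coloring: "ordered_coloring S c"
begin

lemma wt_pos: "k \<le> top_dim S \<Longrightarrow> xs \<in> tuples S k \<Longrightarrow> 0 < wt S k xs"
  using complex unfolding weighted_flag_complex_def by (auto simp: tuples_def)

lemma wt_mset_cong:
  "k \<le> top_dim S \<Longrightarrow> xs \<in> tuples S k \<Longrightarrow> mset ys = mset xs \<Longrightarrow> wt S k ys = wt S k xs"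
  using complex unfolding weighted_flag_complex_def by (auto simp: tuples_def)

lemma inj_on_color: "xs \<in> tuples S k \<Longrightarrow> inj_on c (set xs)"
  using coloring unfolding inj_on_def tuples_def ordered_coloring_def by blast

lemma can_list_tuple:
  assumes "xs \<in> tuples S k"
  shows "mset (can_list c (set xs)) = mset xs"
    and "sorted_wrt (\<lambda>x y. c x < c y) (can_list c (set xs))"
proof -
  let ?ys = "sort_key c xs"
  have "sorted_wrt (<) (map c ?ys)"
    using assms inj_on_color[OF assms] by (simp add: strict_sorted_iff distinct_map tuples_def)
  then have s: "sorted_wrt (\<lambda>x y. c x < c y) ?ys" by (simp add: sorted_wrt_map)
  have "can_list c (set xs) = ?ys" by (rule can_list_eqI) (use s in simp_all)
  then show "mset (can_list c (set xs)) = mset xs"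
    and "sorted_wrt (\<lambda>x y. c x < c y) (can_list c (set xs))" using s by simp_all
qed

lemma can_list_usimplex:
  assumes "s \<in> usimplices S k"
  shows "can_list c s \<in> tuples S k" "set (can_list c s) = s"
    "sorted_wrt (\<lambda>x y. c x < c y) (can_list c s)"
proof -
  obtain xs where xs: "xs \<in> tuples S k" "s = set xs" using assms by (auto simp: usimplices_def)
  note can_list_tuple[OF xs(1), folded xs(2)]
  then show "can_list c s \<in> tuples S k" "set (can_list c s) = s"
    "sorted_wrt (\<lambda>x y. c x < c y) (can_list c s)"
    using xs tuples_mset_cong mset_eq_setD by blast+
qed

lemma tuple_permute_can_listE:
  assumes "xs \<in> tuples S k"
  obtains p where "p permutes {..<Suc k}" "xs = permute_list p (can_list c (set xs))"
proof -
  have "length (can_list c (set xs)) = Suc k"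
    using assms mset_eq_length[OF can_list_tuple(1)[OF assms]] by (simp add: tuples_def)
  then show ?thesis
    using mset_eq_permutation[OF can_list_tuple(1)[OF assms, symmetric]] that by metis
qed

text \<open>All orderings of a simplex carry the same weight, so \<open>uwt\<close> can be computed from any of them.\<close>

lemma uwt_tuple:
  assumes "k \<le> top_dim S" "xs \<in> tuples S k"
  shows "uwt S k (set xs) = wt S k xs"
proof -
  let ?ys = "SOME ys. ys \<in> tuples S k \<and> set ys = set xs"
  have ys: "?ys \<in> tuples S k \<and> set ?ys = set xs"
    by (rule someI[of _ xs]) (use assms in simp)
  then have "mset ?ys = mset xs"
    using assms by (subst set_eq_iff_mset_eq_distinct[symmetric]) (auto simp: tuples_def)
  then show ?thesis unfolding uwt_def using assms wt_mset_cong by blast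
qed

lemma uwt_pos: "k \<le> top_dim S \<Longrightarrow> s \<in> usimplices S k \<Longrightarrow> 0 < uwt S k s"
  using uwt_tuple wt_pos by (auto simp: usimplices_def)

text \<open>A tuple is an ordering of its simplex, hence a permutation of the increasing one; the
  permutation is unique because the vertices are distinct.\<close>

lemma bij_betw_permute_can_list:
  "bij_betw (\<lambda>(p, s). permute_list p (can_list c s))
     ({p. p permutes {..<Suc k}} \<times> usimplices S k) (tuples S k)"
proof (rule bij_betwI')
  fix a b assume "a \<in> {p. p permutes {..<Suc k}} \<times> usimplices S k"
    "b \<in> {p. p permutes {..<Suc k}} \<times> usimplices S k"
  then obtain p s q t where ab: "a = (p, s)" "b = (q, t)" "p permutes {..<Suc k}"
    "q permutes {..<Suc k}" "s \<in> usimplices S k" "t \<in> usimplices S k" by auto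
  note st = can_list_usimplex[OF ab(5)] can_list_usimplex[OF ab(6)]
  have len: "length (can_list c s) = Suc k" "length (can_list c t) = Suc k"
    "distinct (can_list c s)" using st by (auto simp: tuples_def)
  show "((case a of (p, s) \<Rightarrow> permute_list p (can_list c s)) =
      (case b of (p, s) \<Rightarrow> permute_list p (can_list c s))) = (a = b)"
  proof
    assume "(case a of (p, s) \<Rightarrow> permute_list p (can_list c s)) =
      (case b of (p, s) \<Rightarrow> permute_list p (can_list c s))"
    then have eq: "permute_list p (can_list c s) = permute_list q (can_list c t)"
      using ab by simp
    then have "set (can_list c s) = set (can_list c t)"
      using ab len set_permute_list by metis
    then have [simp]: "t = s" using st by simp
    have "p i = q i" for i
    proof (cases "i < Suc k")
      case True
      then have "can_list c s ! p i = can_list c s ! q i"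
        using eq permute_list_nth[of p "can_list c s" i] permute_list_nth[of q "can_list c s" i] ab len
        by simp
      moreover have "p i < Suc k" "q i < Suc k"
        using True ab permutes_in_image[of p "{..<Suc k}" i] permutes_in_image[of q "{..<Suc k}" i]
        by auto
      ultimately show ?thesis using len by (simp add: nth_eq_iff_index_eq)
    next
      case False
      then show ?thesis using ab by (simp add: permutes_def)
    qed
    then show "a = b" using ab by auto
  qed simp
next
  fix a assume "a \<in> {p. p permutes {..<Suc k}} \<times> usimplices S k"
  then obtain p s where a: "a = (p, s)" "p permutes {..<Suc k}" "s \<in> usimplices S k" by auto
  have "length (can_list c s) = Suc k" using can_list_usimplex[OF a(3)] by (simp add: tuples_def)
  then have "mset (permute_list p (can_list c s)) = mset (can_list c s)" using a by simp
  then show "(case a of (p, s) \<Rightarrow> permute_list p (can_list c s)) \<in> tuples S k"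
    using a can_list_usimplex[OF a(3)] tuples_mset_cong by simp blast
next
  fix xs assume xs: "xs \<in> tuples S k"
  obtain p where "p permutes {..<Suc k}" "xs = permute_list p (can_list c (set xs))"
    using tuple_permute_can_listE[OF xs] .
  then show "\<exists>a\<in>{p. p permutes {..<Suc k}} \<times> usimplices S k.
      xs = (case a of (p, s) \<Rightarrow> permute_list p (can_list c s))"
    using xs by (intro bexI[of _ "(p, set xs)"]) (auto simp: usimplices_def)
qed

text \<open>Each simplex is counted once for every ordering. Summability is transferred in both directions,
  so the formula for \<open>infsum\<close> also covers divergent sums, where both sides are zero.\<close>

lemma sum_over_tuples:
  fixes h :: "'v set \<Rightarrow> 'b::{real_normed_algebra_1, banach}"
  assumes g: "\<And>xs. xs \<in> tuples S k \<Longrightarrow> g xs = h (set xs)"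
  shows "g summable_on tuples S k \<longleftrightarrow> h summable_on usimplices S k" (is ?S)
    and "infsum g (tuples S k) = fact (Suc k) * infsum h (usimplices S k)" (is ?I)
proof -
  let ?P = "{p. p permutes {..<Suc k}}"
  let ?b = "\<lambda>(p, s). permute_list p (can_list c s)"
  have P: "finite ?P" "?P \<noteq> {}" "card ?P = fact (Suc k)"
    using finite_permutations[of "{..<Suc k}"] card_permutations[of "{..<Suc k}" "Suc k"]
    by (auto simp del: fact_Suc intro: exI[of _ id] permutes_id)
  have gb: "g (?b a) = (case a of (p, s) \<Rightarrow> h s)" if "a \<in> ?P \<times> usimplices S k" for a
  proof -
    obtain p s where a: "a = (p, s)" "p permutes {..<Suc k}" "s \<in> usimplices S k" using \<open>a \<in> _\<close> by auto
    have "permute_list p (can_list c s) \<in> tuples S k"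
      using bij_betwE[OF bij_betw_permute_can_list[of k]] a by auto
    moreover have "length (can_list c s) = Suc k"
      using can_list_usimplex[OF a(3)] by (simp add: tuples_def)
    ultimately show ?thesis using g a can_list_usimplex[OF a(3)] by simp
  qed
  show ?S
    using summable_on_cong[of "?P \<times> usimplices S k", OF gb] summable_on_reindex_bij_betw[OF bij_betw_permute_can_list[of k], of g]
      summable_on_finite_times_iff[OF P(1,2), of h "usimplices S k"] by simp
  have "infsum g (tuples S k) = infsum (\<lambda>(p, s). h s) (?P \<times> usimplices S k)"
    using infsum_cong[of "?P \<times> usimplices S k", OF gb] infsum_reindex_bij_betw[OF bij_betw_permute_can_list[of k], of g] by simp
  then show ?I using infsum_finite_times[OF P(1,2), of h "usimplices S k"] P(3) by (simp del: fact_Suc)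
qed

section \<open>The unitary operator\<close>

lemma alternating_inversion_sign:
  "alternating (\<lambda>xs. if xs \<in> tuples S k then inversion_sign c xs * g (set xs) else 0)"
proof (rule alternating_restrict_tuples)
  fix ps x y qs assume xs: "ps @ x # y # qs \<in> tuples S k"
  then have "x \<noteq> y" by (auto simp: tuples_def)
  then have "c x \<noteq> c y" using inj_on_color[OF xs] by (auto simp: inj_on_def)
  moreover have "set (ps @ y # x # qs) = set (ps @ x # y # qs)" by auto
  ultimately show "inversion_sign c (ps @ y # x # qs) * g (set (ps @ y # x # qs)) =
      - (inversion_sign c (ps @ x # y # qs) * g (set (ps @ x # y # qs)))"
    by (simp only: inversion_sign_swap[of c x y ps qs, OF \<open>c x \<noteq> c y\<close>] mult_minus_left)
qed

text \<open>Sorting the entries of a tuple by color costs the sign of the sorting permutation. Applying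
  \<open>alternating_permute_list\<close> to the inversion sign itself, which is \<open>1\<close> on increasing tuples,
  identifies that sign.\<close>

lemma skew_cochain_eq_U:
  assumes f: "f \<in> skew_cochains S k" and xs: "xs \<in> tuples S k"
  shows "f (orient xs) = inversion_sign c xs * U S c k f (set xs)"
proof -
  let ?L = "can_list c (set xs)"
  have s: "set xs \<in> usimplices S k" using xs by (auto simp: usimplices_def)
  note L = can_list_usimplex[OF s]
  obtain p where p: "p permutes {..<length ?L}" "xs = permute_list p ?L"
    using tuple_permute_can_listE[OF xs] L(1) by (auto simp: tuples_def)
  have "inversion_sign c xs = of_int (sign p)"
    using alternating_permute_list[OF alternating_inversion_sign[of k "\<lambda>_. 1"] p(1)]
      inversion_sign_sorted[OF L(3)] xs L(1) p(2) by simp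
  then show ?thesis
    using alternating_permute_list[OF skew_cochains_alternating[OF f] p(1)] p(2) s by (simp add: U_def)
qed

lemma bij_betw_U_cochains: "bij_betw (U S c k) (skew_cochains S k) (can_cochains S k)"
proof (rule bij_betwI')
  fix f g assume fg: "f \<in> skew_cochains S k" "g \<in> skew_cochains S k"
  show "U S c k f = U S c k g \<longleftrightarrow> f = g"
  proof
    assume eq: "U S c k f = U S c k g"
    show "f = g"
    proof (rule ext)
      fix \<sigma> show "f \<sigma> = g \<sigma>"
      proof (cases "\<sigma> \<in> osimplices S k")
        case True
        then obtain xs where "xs \<in> tuples S k" "\<sigma> = orient xs" by (auto simp: osimplices_def)
        then show ?thesis using skew_cochain_eq_U fg eq by metis
      next
        case False
        then show ?thesis using fg by (simp add: skew_cochains_def)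
      qed
    qed
  qed simp
next
  fix f show "U S c k f \<in> can_cochains S k" by (simp add: U_def can_cochains_def)
next
  fix g assume g: "g \<in> can_cochains S k"
  \<comment> \<open>The alternating extension of \<open>g\<close> from increasing tuples, whose inversion sign is \<open>1\<close>.\<close>
  let ?F = "\<lambda>xs. if xs \<in> tuples S k then inversion_sign c xs * g (set xs) else 0"
  let ?f = "\<lambda>\<sigma>. if \<sigma> \<in> osimplices S k then ?F (rep \<sigma>) else 0"
  have F: "?F (ps @ y # x # qs) = - ?F (ps @ x # y # qs)" for ps x y qs
    by (rule alternatingD[OF alternating_inversion_sign])
  have f: "?f \<in> skew_cochains S k"
    by (rule skew_cochain_of_tuple_function(1)) (rule F)
  have val: "?f (orient xs) = ?F xs" if "xs \<in> tuples S k" for xs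
    by (rule skew_cochain_of_tuple_function(2)[of S k ?F xs]) (rule F, rule that)
  have "g = U S c k ?f"
  proof (rule ext)
    fix s show "g s = U S c k ?f s"
    proof (cases "s \<in> usimplices S k")
      case True
      note L = can_list_usimplex[OF True]
      have "U S c k ?f s = ?f (orient (can_list c s))" using True by (simp add: U_def)
      also have "\<dots> = ?F (can_list c s)" by (rule val[OF L(1)])
      also have "\<dots> = g s" using L by (simp add: inversion_sign_sorted)
      finally show ?thesis by simp
    next
      case False
      then show ?thesis using g by (simp add: U_def can_cochains_def)
    qed
  qed
  then show "\<exists>f\<in>skew_cochains S k. g = U S c k f" using f by blast
qed

lemma U_inv_U: "f \<in> skew_cochains S k \<Longrightarrow> U_inv S c k (U S c k f) = f"
  using bij_betw_U_cochains unfolding U_inv_def by (simp add: bij_betw_def)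

text \<open>The inversion sign has modulus one and disappears from squared absolute values.\<close>

lemma skew_l2_iff:
  assumes "k \<le> top_dim S" "f \<in> skew_cochains S k"
  shows "f \<in> skew_l2 S k \<longleftrightarrow> U S c k f \<in> can_l2 S k"
proof -
  have "cmod (inversion_sign c xs) = 1" for xs
    using inversion_sign_cases[of c xs] by auto
  then have "wt S k xs * (cmod (f (orient xs)))\<^sup>2 = uwt S k (set xs) * (cmod (U S c k f (set xs)))\<^sup>2"
    if "xs \<in> tuples S k" for xs
    unfolding skew_cochain_eq_U[OF assms(2) that] uwt_tuple[OF assms(1) that]
    by (simp add: norm_mult)
  from sum_over_tuples(1)[of k _ "\<lambda>s. uwt S k s * (cmod (U S c k f s))\<^sup>2", OF this]
  show ?thesis
    using assms bij_betwE[OF bij_betw_U_cochains] by (auto simp: skew_l2_def can_l2_def)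
qed

lemma can_ip_U:
  assumes "k \<le> top_dim S" "f \<in> skew_cochains S k" "g \<in> skew_cochains S k"
  shows "can_ip S k (U S c k f) (U S c k g) = skew_ip S k f g"
proof -
  let ?h = "\<lambda>s. of_real (uwt S k s) * U S c k f s * cnj (U S c k g s)"
  have "of_real (wt S k xs) * f (orient xs) * cnj (g (orient xs)) = ?h (set xs)"
    if xs: "xs \<in> tuples S k" for xs
  proof -
    have "of_real (wt S k xs) * f (orient xs) * cnj (g (orient xs)) =
        (inversion_sign c xs * cnj (inversion_sign c xs)) * ?h (set xs)"
      unfolding skew_cochain_eq_U[OF assms(2) xs] skew_cochain_eq_U[OF assms(3) xs]
        uwt_tuple[OF assms(1) xs] by simp
    then show ?thesis using inversion_sign_cases[of c xs] by auto
  qed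
  from sum_over_tuples(2)[of k _ ?h, OF this] show ?thesis
    by (simp add: skew_ip_def can_ip_def del: fact_Suc)
qed

lemma U_linear:
  "U S c k (\<lambda>x. a * f x + b * g x) = (\<lambda>y. a * U S c k f y + b * U S c k g y)"
  by (auto simp: U_def)

lemma U_l2_image: 
  assumes "k \<le> top_dim S" shows "U S c k ` skew_l2 S k = can_l2 S k"
proof (intro equalityI subsetI)
  fix g assume g: "g \<in> can_l2 S k"
  then have "g \<in> can_cochains S k" by (simp add: can_l2_def)
  then obtain f where "f \<in> skew_cochains S k" "g = U S c k f"
    using bij_betw_U_cochains by (auto simp: bij_betw_def)
  then show "g \<in> U S c k ` skew_l2 S k" using g skew_l2_iff[OF assms] by blast
next
  fix g assume "g \<in> U S c k ` skew_l2 S k"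
  then show "g \<in> can_l2 S k" using skew_l2_iff[OF assms] by (auto simp: skew_l2_def)
qed

lemma unitary_U:
  assumes "k \<le> top_dim S"
  shows "unitary_between (skew_l2 S k) (skew_ip S k) (can_l2 S k) (can_ip S k) (U S c k)"
proof -
  have sub: "skew_l2 S k \<subseteq> skew_cochains S k" by (auto simp: skew_l2_def)
  have "bij_betw (U S c k) (skew_l2 S k) (can_l2 S k)"
    using bij_betw_subset[OF bij_betw_U_cochains sub U_l2_image[OF assms]] .
  then show ?thesis
    unfolding unitary_between_def using U_linear can_ip_U[OF assms] sub by blast
qed

text \<open>A simplex has finitely many orderings, so \<open>U\<close> and its inverse preserve finiteness of the
  support.\<close>

lemma U_core_image: "U S c k ` skew_core S k = can_core S k"
proof (intro equalityI subsetI)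
  fix g assume "g \<in> U S c k ` skew_core S k"
  then obtain f where f: "f \<in> skew_cochains S k" "finite {\<sigma>. f \<sigma> \<noteq> 0}" "g = U S c k f"
    by (auto simp: skew_core_def)
  have "{s. g s \<noteq> 0} \<subseteq> (\<lambda>\<sigma>. set (rep \<sigma>)) ` {\<sigma>. f \<sigma> \<noteq> 0}"
  proof
    fix s assume "s \<in> {s. g s \<noteq> 0}"
    then have s: "s \<in> usimplices S k" "f (orient (can_list c s)) \<noteq> 0"
      using f(3) by (auto simp: U_def split: if_splits)
    moreover have "set (rep (orient (can_list c s))) = s"
      using can_list_usimplex(2)[OF s(1)] mset_eq_setD[OF mset_rep_orient] by metis
    ultimately show "s \<in> (\<lambda>\<sigma>. set (rep \<sigma>)) ` {\<sigma>. f \<sigma> \<noteq> 0}" by force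
  qed
  then have "finite {s. g s \<noteq> 0}" using f(2) finite_surj by blast
  then show "g \<in> can_core S k"
    using f bij_betwE[OF bij_betw_U_cochains] by (auto simp: can_core_def)
next
  fix g assume g: "g \<in> can_core S k"
  then have "g \<in> can_cochains S k" by (simp add: can_core_def)
  then obtain f where f: "f \<in> skew_cochains S k" "g = U S c k f"
    using bij_betw_U_cochains by (auto simp: bij_betw_def)
  have "{\<sigma>. f \<sigma> \<noteq> 0} \<subseteq> (\<Union>s\<in>{s. g s \<noteq> 0}. orient ` {xs. set xs \<subseteq> s \<and> length xs = Suc k})"
  proof
    fix \<sigma> assume \<sigma>: "\<sigma> \<in> {\<sigma>. f \<sigma> \<noteq> 0}"
    then have "\<sigma> \<in> osimplices S k" using f(1) by (auto simp: skew_cochains_def)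
    then obtain xs where xs: "xs \<in> tuples S k" "\<sigma> = orient xs" by (auto simp: osimplices_def)
    then have "g (set xs) \<noteq> 0" using \<sigma> skew_cochain_eq_U[OF f(1) xs(1)] f(2) by auto
    moreover have "length xs = Suc k" using xs(1) by (simp add: tuples_def)
    ultimately show "\<sigma> \<in> (\<Union>s\<in>{s. g s \<noteq> 0}. orient ` {xs. set xs \<subseteq> s \<and> length xs = Suc k})"
      using xs(2) by blast
  qed
  moreover have "finite s" if "g s \<noteq> 0" for s
  proof -
    have "s \<in> usimplices S k" using that g by (auto simp: can_core_def can_cochains_def)
    then show ?thesis by (auto simp: usimplices_def)
  qed
  then have "finite (\<Union>s\<in>{s. g s \<noteq> 0}. orient ` {xs. set xs \<subseteq> s \<and> length xs = Suc k})"
    using g by (auto simp: can_core_def intro!: finite_UN_I finite_lists_length_eq)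
  ultimately have "finite {\<sigma>. f \<sigma> \<noteq> 0}" by (rule finite_subset)
  then show "g \<in> U S c k ` skew_core S k" using f by (auto simp: skew_core_def)
qed

lemma wt_rep_orient: "k \<le> top_dim S \<Longrightarrow> xs \<in> tuples S k \<Longrightarrow> wt S k (rep (orient xs)) = wt S k xs"
  by (rule wt_mset_cong) simp_all

lemma U_skew_mult:
  assumes "k \<le> top_dim S"
  shows "U S c k (skew_mult S k f) = can_mult S k (U S c k f)"
proof (rule ext)
  fix s show "U S c k (skew_mult S k f) s = can_mult S k (U S c k f) s"
  proof (cases "s \<in> usimplices S k")
    case True
    note L = can_list_usimplex[OF True]
    have "wt S k (rep (orient (can_list c s))) = uwt S k s"
      using wt_rep_orient[OF assms L(1)] uwt_tuple[OF assms L(1)] L(2) by simp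
    then show ?thesis by (simp add: U_def skew_mult_def can_mult_def)
  qed (simp add: U_def can_mult_def)
qed

lemma skew_mult_in_skew_cochains:
  assumes k: "k \<le> top_dim S" and f: "f \<in> skew_cochains S k"
  shows "skew_mult S k f \<in> skew_cochains S k"
proof -
  have val: "skew_mult S k f (orient xs) = of_real (wt S k xs) * f (orient xs)"
    if "xs \<in> tuples S k" for xs
    using wt_rep_orient[OF k that] by (simp add: skew_mult_def)
  have "skew_mult S k f (orient (permute_list p xs)) = of_int (sign p) * skew_mult S k f (orient xs)"
    if xs: "xs \<in> tuples S k" and p: "p permutes {..<Suc k}" for xs p
  proof -
    have "length xs = Suc k" using xs by (simp add: tuples_def)
    then have m: "mset (permute_list p xs) = mset xs" using p by simp
    then have "permute_list p xs \<in> tuples S k" using xs tuples_mset_cong by blast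
    moreover have "f (orient (permute_list p xs)) = of_int (sign p) * f (orient xs)"
      using f xs p by (simp add: skew_cochains_def)
    ultimately show ?thesis
      by (simp only: val[OF xs] val[of "permute_list p xs"] wt_mset_cong[OF k xs m] mult.left_commute)
  qed
  moreover have "skew_mult S k f \<sigma> = 0" if "\<sigma> \<notin> osimplices S k" for \<sigma>
    using f that by (simp add: skew_mult_def skew_cochains_def)
  ultimately show ?thesis unfolding skew_cochains_def by blast
qed

lemma skew_mult_in_l2_iff:
  assumes "k \<le> top_dim S" "f \<in> skew_cochains S k"
  shows "skew_mult S k f \<in> skew_l2 S k \<longleftrightarrow> can_mult S k (U S c k f) \<in> can_l2 S k"
  using skew_l2_iff[OF assms(1) skew_mult_in_skew_cochains[OF assms]] U_skew_mult[OF assms(1)] by simp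

section \<open>Coboundary and codifferential in the two models\<close>

text \<open>Exchanging two entries of the face exchanges the same two entries in every tuple \<open>z # xs\<close> of the
  sum, while the weights and the range of summation stay the same. A \<open>z\<close> for which \<open>z # xs\<close> is
  not a tuple contributes zero, since \<open>g\<close> vanishes there.\<close>

lemma delta_skew_in_skew_cochains:
  assumes g: "g \<in> skew_cochains S k"
  shows "delta_skew S k g \<in> skew_cochains S (k - 1)"
proof (cases "1 \<le> k \<and> k \<le> top_dim S")
  case True
  let ?E = "\<lambda>xs. 1 / of_real (wt S (k - 1) xs) *
    (\<Sum>\<^sub>\<infinity>x\<in>common_nbhd S xs. of_real (wt S k (x # xs)) * g (orient (x # xs)))"
  have "delta_skew S k g = (\<lambda>\<sigma>. if \<sigma> \<in> osimplices S (k - 1) then ?E (rep \<sigma>) else 0)"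
    using True by (intro ext) (simp add: delta_skew_def)
  moreover have "(\<lambda>\<sigma>. if \<sigma> \<in> osimplices S (k - 1) then ?E (rep \<sigma>) else 0) \<in> skew_cochains S (k - 1)"
  proof (rule skew_cochain_of_tuple_function(1))
    fix ps x y qs assume xs: "ps @ x # y # qs \<in> tuples S (k - 1)"
    let ?xs = "ps @ x # y # qs" and ?ys = "ps @ y # x # qs"
    have "wt S (k - 1) ?ys = wt S (k - 1) ?xs"
      using True by (intro wt_mset_cong[OF _ xs]) auto
    moreover have "common_nbhd S ?ys = common_nbhd S ?xs" by (auto simp: common_nbhd_def)
    moreover have "of_real (wt S k (z # ?ys)) * g (orient (z # ?ys)) =
        - (of_real (wt S k (z # ?xs)) * g (orient (z # ?xs)))" for z
    proof -
      have *: "g (orient (z # ?ys)) = - g (orient (z # ?xs))"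
        using alternatingD[OF skew_cochains_alternating[OF g], of "z # ps" y x qs] by simp
      show ?thesis
      proof (cases "z # ?xs \<in> tuples S k")
        case in_tuples: True
        then have "wt S k (z # ?ys) = wt S k (z # ?xs)"
          using True by (intro wt_mset_cong) auto
        then show ?thesis using * by simp
      next
        case False
        then show ?thesis using * skew_cochains_eq_0[OF g False] by simp
      qed
    qed
    ultimately show "?E ?ys = - ?E ?xs" by (simp add: infsum_uminus)
  qed
  ultimately show ?thesis by simp
qed (auto simp: delta_skew_def skew_cochains_def)

text \<open>A face of an increasing tuple is the increasing tuple of its own vertices. This is why no signs
  other than \<open>(-1) ^ i\<close> occur in the coboundary of the canonical model.\<close>

lemma face_can_list:
  assumes "s \<in> usimplices S (Suc k)" "i \<le> Suc k"
  shows "face i (can_list c s) \<in> tuples S k"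
    and "can_list c (set (face i (can_list c s))) = face i (can_list c s)"
proof -
  let ?L = "can_list c s"
  note L = can_list_usimplex[OF assms(1)]
  have len: "length ?L = Suc (Suc k)" using L(1) by (simp add: tuples_def)
  then have split: "?L = take i ?L @ ?L ! i # drop (Suc i) ?L"
    using assms(2) by (simp add: id_take_nth_drop)
  have sub: "set (face i ?L) \<subseteq> set ?L"
    by (auto simp: face_def dest: in_set_takeD in_set_dropD)
  have "distinct (take i ?L @ ?L ! i # drop (Suc i) ?L)"
    by (rule iffD1[OF arg_cong[OF split, of distinct]]) (use L(1) in \<open>simp add: tuples_def\<close>)
  then have "distinct (face i ?L)" by (simp add: face_def)
  moreover have "length (face i ?L) = Suc k" using len assms(2) by (simp add: face_def)
  ultimately show "face i ?L \<in> tuples S k"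
    using L(1) sub by (auto simp: tuples_def)
  have "sorted_wrt (\<lambda>x y. c x < c y) (take i ?L @ ?L ! i # drop (Suc i) ?L)"
    by (rule iffD1[OF arg_cong[OF split, of "sorted_wrt (\<lambda>x y. c x < c y)"] L(3)])
  then have "sorted_wrt (\<lambda>x y. c x < c y) (face i ?L)" by (simp add: face_def sorted_wrt_append)
  then show "can_list c (set (face i ?L)) = face i ?L" by (rule can_list_eqI[OF refl])
qed

lemma d_can_conv_alt_face_sum:
  assumes "1 \<le> k" "k \<le> top_dim S" "s \<in> usimplices S k"
  shows "d_can S c k f s = alt_face_sum (\<lambda>xs. f (set xs)) (can_list c s)"
proof -
  have "length (can_list c s) = Suc k" using can_list_usimplex(1)[OF assms(3)] by (simp add: tuples_def)
  then show ?thesis using assms by (simp add: d_can_def alt_face_sum_def lessThan_Suc_atMost)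
qed

lemma alt_face_sum_can_list_cong:
  assumes "s \<in> usimplices S (Suc k)"
    and "\<And>xs. xs \<in> tuples S k \<Longrightarrow> can_list c (set xs) = xs \<Longrightarrow> F xs = G xs"
  shows "alt_face_sum F (can_list c s) = alt_face_sum G (can_list c s)"
proof -
  have "length (can_list c s) = Suc (Suc k)"
    using can_list_usimplex(1)[OF assms(1)] by (simp add: tuples_def)
  then show ?thesis
    unfolding alt_face_sum_def using face_can_list[OF assms(1)] assms(2)
    by (intro sum.cong) auto
qed

lemma U_d_skew:
  assumes "f \<in> skew_cochains S (k - 1)"
  shows "U S c k (d_skew S k f) = d_can S c k (U S c (k - 1) f)"
proof (rule ext)
  fix s show "U S c k (d_skew S k f) s = d_can S c k (U S c (k - 1) f) s"
  proof (cases "1 \<le> k \<and> k \<le> top_dim S \<and> s \<in> usimplices S k")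
    case True
    then have s: "s \<in> usimplices S (Suc (k - 1))" by simp
    have "U S c k (d_skew S k f) s = alt_face_sum (\<lambda>xs. f (orient xs)) (can_list c s)"
      using True d_skew_in_skew_cochains(2)[OF assms] can_list_usimplex(1)[of s k]
      by (simp add: U_def)
    also have "\<dots> = alt_face_sum (\<lambda>xs. U S c (k - 1) f (set xs)) (can_list c s)"
      by (rule alt_face_sum_can_list_cong[OF s]) (auto simp: U_def usimplices_def)
    also have "\<dots> = d_can S c k (U S c (k - 1) f) s"
      using True by (simp add: d_can_conv_alt_face_sum)
    finally show ?thesis .
  qed (auto simp: U_def d_skew_def d_can_def)
qed

text \<open>The outer and inner coboundary are alternating face sums of increasing tuples, and
  \<open>alt_face_sum_can_list_cong\<close> identifies the inner one on every face that occurs.\<close>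

lemma d_can_d_can: "d_can S c (Suc k) (d_can S c k f) = (\<lambda>_. 0)"
proof (rule ext)
  fix s show "d_can S c (Suc k) (d_can S c k f) s = 0"
  proof (cases "1 \<le> k \<and> Suc k \<le> top_dim S \<and> s \<in> usimplices S (Suc k)")
    case True
    then have "d_can S c (Suc k) (d_can S c k f) s = alt_face_sum (\<lambda>xs. d_can S c k f (set xs)) (can_list c s)"
      by (simp add: d_can_conv_alt_face_sum)
    also have "\<dots> = alt_face_sum (alt_face_sum (\<lambda>xs. f (set xs))) (can_list c s)"
    proof (rule alt_face_sum_can_list_cong)
      fix xs assume xs: "xs \<in> tuples S k" "can_list c (set xs) = xs"
      have "d_can S c k f (set xs) = alt_face_sum (\<lambda>xs. f (set xs)) (can_list c (set xs))"
        by (rule d_can_conv_alt_face_sum) (use True xs in \<open>auto simp: usimplices_def\<close>)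
      then show "d_can S c k f (set xs) = alt_face_sum (\<lambda>xs. f (set xs)) xs" using xs by simp
    qed (use True in simp)
    finally show ?thesis by (simp add: alt_face_sum_alt_face_sum)
  qed (auto simp: d_can_def)
qed

lemma delta_can_U: "f \<in> skew_cochains S k \<Longrightarrow> delta_can S c k (U S c k f) = U S c (k - 1) (delta_skew S k f)"
  by (simp add: delta_can_def U_inv_U)

lemma U_laplace_skew:
  assumes f: "f \<in> skew_cochains S k"
  shows "U S c k (laplace_skew S k f) = laplace_can S c k (U S c k f)"
proof -
  have d: "d_skew S (Suc k) f \<in> skew_cochains S (Suc k)"
    by (rule d_skew_in_skew_cochains) (use f in simp)
  have 1: "U S c k (d_skew S k (delta_skew S k f)) = d_can S c k (delta_can S c k (U S c k f))"
    by (simp only: delta_can_U[OF f] U_d_skew[OF delta_skew_in_skew_cochains[OF f]])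
  have "U S c (Suc k) (d_skew S (Suc k) f) = d_can S c (Suc k) (U S c k f)"
    using U_d_skew[of f "Suc k"] f by simp
  then have 2: "U S c k (delta_skew S (Suc k) (d_skew S (Suc k) f)) =
      delta_can S c (Suc k) (d_can S c (Suc k) (U S c k f))"
    using delta_can_U[OF d] by simp
  have "U S c k (laplace_skew S k f) = (\<lambda>s. U S c k (d_skew S k (delta_skew S k f)) s +
      U S c k (delta_skew S (Suc k) (d_skew S (Suc k) f)) s)"
    by (auto simp: U_def laplace_skew_def)
  then show ?thesis by (simp add: 1 2 laplace_can_def)
qed

text \<open>For \<open>k = top_dim S\<close> the coboundary terms are zero by definition; they are
  treated apart because \<open>can_ip_U\<close> is about simplices that carry weights of the complex.\<close>

lemma form_can_U:
  assumes k: "k \<le> top_dim S" and u: "u \<in> skew_cochains S k" and v: "v \<in> skew_cochains S k"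
  shows "form_can S c k (U S c k u) (U S c k v) = form_skew S k u v"
proof -
  have d: "d_can S c (Suc k) (U S c k f) = U S c (Suc k) (d_skew S (Suc k) f)"
    "d_skew S (Suc k) f \<in> skew_cochains S (Suc k)" if "f \<in> skew_cochains S k" for f
    using U_d_skew[of f "Suc k"] d_skew_in_skew_cochains(1)[of f S "Suc k"] that by simp_all
  have "can_ip S (Suc k) (d_can S c (Suc k) (U S c k u)) (d_can S c (Suc k) (U S c k v)) =
      skew_ip S (Suc k) (d_skew S (Suc k) u) (d_skew S (Suc k) v)"
  proof (cases "Suc k \<le> top_dim S")
    case True
    then show ?thesis using u v by (simp add: d can_ip_U)
  next
    case False
    then show ?thesis by (simp add: d_can_def d_skew_def can_ip_def skew_ip_def)
  qed
  moreover have "can_ip S (k - 1) (delta_can S c k (U S c k u)) (delta_can S c k (U S c k v)) =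
      skew_ip S (k - 1) (delta_skew S k u) (delta_skew S k v)"
    unfolding delta_can_U[OF u] delta_can_U[OF v]
    by (rule can_ip_U[OF _ delta_skew_in_skew_cochains[OF u] delta_skew_in_skew_cochains[OF v]])
      (use k in simp)
  ultimately show ?thesis by (simp add: form_can_def form_skew_def)
qed

section \<open>Square summable cochains and pointwise limits\<close>

lemma can_l2_diff:
  assumes k: "k \<le> top_dim S" and f: "f \<in> can_l2 S k" and g: "g \<in> can_l2 S k"
  shows "(\<lambda>s. f s - g s) \<in> can_l2 S k"
proof -
  have "(\<lambda>s. 2 * (uwt S k s * (cmod (f s))\<^sup>2) + 2 * (uwt S k s * (cmod (g s))\<^sup>2)) summable_on usimplices S k"
    using f g by (intro summable_on_add summable_on_cmult_right) (auto simp: can_l2_def)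
  moreover have "uwt S k s * (cmod (f s - g s))\<^sup>2 \<le>
      2 * (uwt S k s * (cmod (f s))\<^sup>2) + 2 * (uwt S k s * (cmod (g s))\<^sup>2)" if "s \<in> usimplices S k" for s
  proof -
    have "(cmod (f s - g s))\<^sup>2 \<le> (cmod (f s) + cmod (g s))\<^sup>2"
      by (intro power_mono norm_triangle_ineq4) simp
    also have "\<dots> \<le> 2 * (cmod (f s))\<^sup>2 + 2 * (cmod (g s))\<^sup>2"
      using sum_squares_bound[of "cmod (f s)" "cmod (g s)"] by (simp add: power2_sum)
    finally have "uwt S k s * (cmod (f s - g s))\<^sup>2 \<le> uwt S k s * (2 * (cmod (f s))\<^sup>2 + 2 * (cmod (g s))\<^sup>2)"
      using uwt_pos[OF k that] by (intro mult_left_mono) auto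
    then show ?thesis by (simp add: algebra_simps)
  qed
  ultimately have "(\<lambda>s. uwt S k s * (cmod (f s - g s))\<^sup>2) summable_on usimplices S k"
    using uwt_pos[OF k] by (elim summable_on_comparison_test) (auto simp: less_imp_le)
  then show ?thesis using f g by (auto simp: can_l2_def can_cochains_def)
qed

lemma can_core_subset_l2: "can_core S k \<subseteq> can_l2 S k"
proof
  fix f assume f: "f \<in> can_core S k"
  have "(\<lambda>s. uwt S k s * (cmod (f s))\<^sup>2) summable_on {s. f s \<noteq> 0}"
    using f by (intro summable_on_finite) (simp add: can_core_def)
  moreover have "(\<lambda>s. uwt S k s * (cmod (f s))\<^sup>2) summable_on {s. f s \<noteq> 0} \<longleftrightarrow>
      (\<lambda>s. uwt S k s * (cmod (f s))\<^sup>2) summable_on usimplices S k"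
    by (rule summable_on_cong_neutral) (use f in \<open>auto simp: can_core_def can_cochains_def\<close>)
  ultimately show "f \<in> can_l2 S k" using f by (auto simp: can_l2_def can_core_def)
qed

text \<open>One term of a sum of nonnegative terms is at most the sum. With positive weights this bounds
  evaluation at a simplex by the norm.\<close>

lemma can_ip_pointwise_bound:
  assumes k: "k \<le> top_dim S" and f: "f \<in> can_l2 S k" and s: "s \<in> usimplices S k"
  shows "sqrt (uwt S k s) * cmod (f s) \<le> sqrt (Re (can_ip S k f f))"
proof -
  let ?w = "\<lambda>s. uwt S k s * (cmod (f s))\<^sup>2"
  have "can_ip S k f f = (\<Sum>\<^sub>\<infinity>s\<in>usimplices S k. complex_of_real (?w s))"
    unfolding can_ip_def by (intro infsum_cong) (simp add: mult.assoc flip: complex_norm_square)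
  also have "\<dots> = of_real (infsum ?w (usimplices S k))" 
    using f by (intro infsumI has_sum_of_real has_sum_infsum) (simp add: can_l2_def)
  finally have "Re (can_ip S k f f) = infsum ?w (usimplices S k)" by simp
  moreover have "sum ?w {s} \<le> infsum ?w (usimplices S k)"
    using f s uwt_pos[OF k] by (intro finite_sum_le_infsum) (auto simp: can_l2_def less_imp_le)
  ultimately have "sqrt (uwt S k s * (cmod (f s))\<^sup>2) \<le> sqrt (Re (can_ip S k f f))" by simp
  then show ?thesis by (simp add: real_sqrt_mult)
qed

lemma norm_conv_pointwise:
  assumes k: "k \<le> top_dim S" and us: "\<And>j. us j \<in> can_l2 S k" and u: "u \<in> can_l2 S k"
    and conv: "norm_conv (can_ip S k) us u"
  shows "(\<lambda>j. us j s) \<longlonglongrightarrow> u s"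
proof (cases "s \<in> usimplices S k")
  case True
  have pos: "0 < sqrt (uwt S k s)" using uwt_pos[OF k True] by simp
  let ?N = "\<lambda>j. sqrt (Re (can_ip S k (\<lambda>x. us j x - u x) (\<lambda>x. us j x - u x)))"
  have bound: "cmod (us j s - u s) \<le> ?N j / sqrt (uwt S k s)" for j
    using can_ip_pointwise_bound[OF k can_l2_diff[OF k us[of j] u] True] pos
    by (simp add: pos_le_divide_eq mult.commute)
  have "(\<lambda>j. ?N j / sqrt (uwt S k s)) \<longlonglongrightarrow> 0 / sqrt (uwt S k s)"
    using conv pos by (intro tendsto_divide tendsto_const) (auto simp: norm_conv_def)
  then have "(\<lambda>j. ?N j / sqrt (uwt S k s)) \<longlonglongrightarrow> 0" by simp
  then have "(\<lambda>j. us j s - u s) \<longlonglongrightarrow> 0"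
    by (rule Lim_null_comparison[OF always_eventually[OF allI[OF bound]]])
  then show ?thesis by (simp add: LIM_zero_iff)
next
  case False
  then show ?thesis using us u by (auto simp: can_l2_def can_cochains_def)
qed

text \<open>Along an approximating sequence both the cochains and their coboundaries converge pointwise, and
  a value of \<open>d\<close> involves only finitely many values of its argument.\<close>

lemma d_can_closed_pointwise:
  assumes "(u, v) \<in> d_can_closed S c k" "k \<le> top_dim S"
  shows "v = d_can S c k u"
proof (rule ext)
  fix s
  obtain us where us: "\<And>j. us j \<in> can_core S (k - 1)" "\<And>j. d_can S c k (us j) \<in> can_l2 S k"
    "norm_conv (can_ip S (k - 1)) us u" "norm_conv (can_ip S k) (\<lambda>j. d_can S c k (us j)) v"
    and uv: "u \<in> can_l2 S (k - 1)" "v \<in> can_l2 S k"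
    using assms(1) unfolding d_can_closed_def closed_op_def by blast
  have "(\<lambda>j. us j t) \<longlonglongrightarrow> u t" for t
    by (rule norm_conv_pointwise[OF _ _ uv(1) us(3)]) (use assms(2) us(1) can_core_subset_l2 in auto)
  then have "(\<lambda>j. d_can S c k (us j) s) \<longlonglongrightarrow> d_can S c k u s"
    by (cases "1 \<le> k \<and> k \<le> top_dim S \<and> s \<in> usimplices S k")
      (auto simp: d_can_def intro!: tendsto_sum tendsto_mult_left)
  moreover have "(\<lambda>j. d_can S c k (us j) s) \<longlonglongrightarrow> v s"
    by (rule norm_conv_pointwise[OF assms(2) us(2) uv(2) us(4)])
  ultimately show "v s = d_can S c k u s" by (rule LIMSEQ_unique[symmetric])
qed

lemma skew_l2_diff:
  assumes k: "k \<le> top_dim S" and f: "f \<in> skew_l2 S k" and g: "g \<in> skew_l2 S k"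
  shows "(\<lambda>x. f x - g x) \<in> skew_l2 S k"
proof -
  have "(\<lambda>x. f x - g x) \<in> skew_cochains S k"
    using f g by (auto simp: skew_l2_def skew_cochains_def right_diff_distrib)
  moreover have "U S c k (\<lambda>x. f x - g x) = (\<lambda>s. U S c k f s - U S c k g s)" by (auto simp: U_def)
  moreover have "U S c k f \<in> can_l2 S k" "U S c k g \<in> can_l2 S k"
    using f g U_l2_image[OF k] by auto
  ultimately show ?thesis using skew_l2_iff[OF k] can_l2_diff[OF k] by simp
qed

lemma skew_core_diff:
  assumes "f \<in> skew_core S k" "g \<in> skew_core S k"
  shows "(\<lambda>x. f x - g x) \<in> skew_core S k"
proof -
  have "finite ({\<sigma>. f \<sigma> \<noteq> 0} \<union> {\<sigma>. g \<sigma> \<noteq> 0})" using assms by (simp add: skew_core_def)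
  then have "finite {\<sigma>. f \<sigma> - g \<sigma> \<noteq> 0}" by (rule rev_finite_subset) auto
  then show ?thesis
    using assms by (auto simp: skew_core_def skew_cochains_def right_diff_distrib)
qed

lemma skew_core_subset_l2:
  assumes k: "k \<le> top_dim S" shows "skew_core S k \<subseteq> skew_l2 S k"
proof
  fix f assume f: "f \<in> skew_core S k"
  then have "U S c k f \<in> can_l2 S k" using U_core_image can_core_subset_l2 by blast
  then show "f \<in> skew_l2 S k" using f skew_l2_iff[OF k] by (auto simp: skew_core_def)
qed

section \<open>Intertwining of the Laplacians\<close>

lemma conjugate_laplace_skew:
  "conjugate_op (U S c k) (op_on (skew_core S k) (laplace_skew S k)) = op_on (can_core S k) (laplace_can S c k)"
proof -
  have "U S c k (laplace_skew S k f) = laplace_can S c k (U S c k f)" if "f \<in> skew_core S k" for f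
    using that by (intro U_laplace_skew) (simp add: skew_core_def)
  then show ?thesis
    unfolding conjugate_op_def op_on_def U_core_image[symmetric] by auto
qed

lemma conjugate_laplace_skew_F:
  assumes k: "k \<le> top_dim S"
  shows "conjugate_op (U S c k) (laplace_skew_F S k) = laplace_can_F S c k"
proof -
  interpret unitary_transport "skew_l2 S k" "skew_core S k" "can_l2 S k" "skew_ip S k" "form_skew S k"
    "can_ip S k" "form_can S c k" "U S c k"
  proof unfold_locales
    show "form_can S c k (U S c k f) (U S c k g) = form_skew S k f g"
      if "f \<in> skew_core S k" "g \<in> skew_core S k" for f g
      using that by (intro form_can_U[OF k]) (simp_all add: skew_core_def)
  qed (fact unitary_U[OF k] skew_l2_diff[OF k] skew_core_subset_l2[OF k] skew_core_diff)+
  show ?thesis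
    using conjugate_friedrichs_op unfolding laplace_skew_F_def laplace_can_F_def U_core_image .
qed

end

theorem theorem5p5:
  fixes S :: "'v wcomplex" and c :: "'v \<Rightarrow> 'c::linorder"
  assumes "weighted_flag_complex S" and "ordered_coloring S c"
  shows
    "(\<forall>k\<le>top_dim S.
        unitary_between (skew_l2 S k) (skew_ip S k) (can_l2 S k) (can_ip S k) (U S c k) \<and>
        (\<forall>f\<in>skew_l2 S k.
           (skew_mult S k f \<in> skew_l2 S k \<longleftrightarrow> can_mult S k (U S c k f) \<in> can_l2 S k) \<and>
           U S c k (skew_mult S k f) = can_mult S k (U S c k f))) \<and>
     (\<forall>k. 1 \<le> k \<and> k \<le> top_dim S - 1 \<longrightarrow>
        (\<forall>f\<in>can_cochains S (k - 1). d_can S c (Suc k) (d_can S c k f) = (\<lambda>_. 0))) \<and>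
     (\<forall>k\<le>top_dim S.
        conjugate_op (U S c k) (op_on (skew_core S k) (laplace_skew S k)) =
          op_on (can_core S k) (laplace_can S c k)) \<and>
     (\<forall>k. 1 \<le> k \<and> k \<le> top_dim S - 1 \<longrightarrow>
        (\<forall>u v w. (u, v) \<in> d_can_closed S c k \<and> (v, w) \<in> d_can_closed S c (Suc k) \<longrightarrow>
           w = (\<lambda>_. 0))) \<and>
     (\<forall>k\<le>top_dim S.
        conjugate_op (U S c k) (laplace_skew_F S k) = laplace_can_F S c k)"
proof -
  interpret colored_complex S c by (rule colored_complex.intro) (fact assms)+
  have closed: "w = (\<lambda>_. 0)"
    if "1 \<le> k \<and> k \<le> top_dim S - 1" "(u, v) \<in> d_can_closed S c k" "(v, w) \<in> d_can_closed S c (Suc k)"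
    for k u v w
  proof -
    have "k \<le> top_dim S" "Suc k \<le> top_dim S" using that(1) by auto
    then have "v = d_can S c k u" "w = d_can S c (Suc k) v"
      using that d_can_closed_pointwise by blast+
    then show ?thesis by (simp add: d_can_d_can)
  qed
  have l2: "f \<in> skew_cochains S k" if "f \<in> skew_l2 S k" for f k using that by (simp add: skew_l2_def)
  show ?thesis
    by (intro conjI allI impI ballI unitary_U skew_mult_in_l2_iff U_skew_mult d_can_d_can
        conjugate_laplace_skew conjugate_laplace_skew_F)
      (use l2 closed in blast)+
qed

end
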